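(* Let $K$ be a field of characteristic $0$, let $k \ge 2$, and let $F = \sum_{n=1}^\infty f(n) x^n \in K[[x]]$ be a $k$-Mahler series. Suppose that there exists $q \in \mathbb Z_{\ge 3}$ such that (i) $f(qn)=f(q)f(n)$ for all $n \in \mathbb N$; (ii) for the splitting field $L$ of $\mathfrak d_k F$ over the prime field of $K$, the only $q$-th root of unity in $L$ is $1$; (iii) $\gcd(q,k)=1$. Then $F$ is $k$-regular.
   Context: $F$ is $k$-Mahler if there are $n\ge1$ and $P_0,\dots,P_n\in K[x]$, $P_0\neq0$, with $P_0(x)F(x)=\sum_{j=1}^n P_j(x)F(x^{k^j})$; the polynomials $P_0$ so occurring (with $0$) form an ideal of $K[x]$, and the Mahler denominator $\mathfrak d_kF$ is its generator with lowest-degree nonzero coefficient $1$. The splitting field $L$ is the subfield of an algebraic closure of $K$ generated over the prime field by the roots of $\mathfrak d_kF$. $F$ is $k$-regular if the $K$-vector space spanned by the $k$-kernel $\{(f(k^e n+r))_{n\ge 0} : e\ge 0,\ 0\le r<k^e\}$ of its coefficient sequence (with $f(0)=0$) is finite-dimensional. No multiplicativity of $f$ is assumed. *)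

theory Defs
  imports
    "HOL-Algebra.Generated_Fields"
    "HOL-Algebra.Algebraic_Closure_Type"
    "HOL-Computational_Algebra.Polynomial_FPS"
    "HOL-Library.Function_Algebras"
begin

definition mahler_equation :: "nat \<Rightarrow> 'a::field fps \<Rightarrow> 'a poly \<Rightarrow> bool" where
  "mahler_equation k F P0 \<longleftrightarrow> (\<exists>n\<ge>1. \<exists>P :: nat \<Rightarrow> 'a poly.
     fps_of_poly P0 * F = (\<Sum>j=1..n. fps_of_poly (P j) * (F oo fps_X ^ (k ^ j))))"

definition mahler :: "nat \<Rightarrow> 'a::field fps \<Rightarrow> bool" where
  "mahler k F \<longleftrightarrow> (\<exists>P0. P0 \<noteq> 0 \<and> mahler_equation k F P0)"

definition mahler_ideal :: "nat \<Rightarrow> 'a::field fps \<Rightarrow> 'a poly set" where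
  "mahler_ideal k F = insert 0 {P0. P0 \<noteq> 0 \<and> mahler_equation k F P0}"

(* For a Mahler series the description below is satisfied by exactly one polynomial, see
   mahler_denom_ex1. For other series the ideal is 0 and the value is unspecified. *)
definition mahler_denom :: "nat \<Rightarrow> 'a::field fps \<Rightarrow> 'a poly" where
  "mahler_denom k F = (THE d. mahler_ideal k F = {p. d dvd p} \<and>
     coeff d (LEAST i. coeff d i \<noteq> 0) = 1)"

(* A generated field contains 1, hence the prime field. The ambient algebraic closure is the
   library type of K, into which K embeds by to_ac. *)
definition mahler_splitting_field :: "nat \<Rightarrow> 'a::field fps \<Rightarrow> 'a alg_closure set" where
  "mahler_splitting_field k F =
     generate_field ring_of_type_algebra {z. poly (map_poly to_ac (mahler_denom k F)) z = 0}"

definition k_kernel :: "nat \<Rightarrow> (nat \<Rightarrow> 'a) \<Rightarrow> (nat \<Rightarrow> 'a) set" where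
  "k_kernel k f = {(\<lambda>n. f (k ^ e * n + r)) | e r. r < k ^ e}"

abbreviation seq_span :: "(nat \<Rightarrow> 'a::field) set \<Rightarrow> (nat \<Rightarrow> 'a) set" where
  "seq_span \<equiv> module.span (\<lambda>c g n. c * g n)"

definition k_regular :: "nat \<Rightarrow> 'a::field fps \<Rightarrow> bool" where
  "k_regular k F \<longleftrightarrow> (\<exists>B. finite B \<and> seq_span B = seq_span (k_kernel k (fps_nth F)))"

lemma seq_vector_space: "vector_space (\<lambda>(c::'a::field) (g::nat \<Rightarrow> 'a) n. c * g n)"
  by unfold_locales (auto simp: fun_eq_iff algebra_simps)

lemma mem_mahler_ideal_iff: "p \<in> mahler_ideal k F \<longleftrightarrow> mahler_equation k F p"
proof -
  have "mahler_equation k F 0"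
    unfolding mahler_equation_def by (intro exI[of _ 1] conjI exI[of _ "\<lambda>_. 0"]) auto
  then show ?thesis
    by (auto simp: mahler_ideal_def)
qed

lemma mahler_ideal_add:
  assumes "p \<in> mahler_ideal k F" "q \<in> mahler_ideal k F"
  shows "p + q \<in> mahler_ideal k F"
proof -
  have pad: "(\<Sum>j=1..n. fps_of_poly (P j) * (F oo fps_X ^ (k ^ j))) =
      (\<Sum>j=1..m. fps_of_poly (if j \<le> n then P j else 0) * (F oo fps_X ^ (k ^ j)))"
    if "n \<le> m" for n m :: nat and P
    using that by (intro sum.mono_neutral_cong_left) auto
  from assms obtain n P m Q where
    n: "n \<ge> 1" "fps_of_poly p * F = (\<Sum>j=1..n. fps_of_poly (P j) * (F oo fps_X ^ (k ^ j)))" and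
    m: "m \<ge> 1" "fps_of_poly q * F = (\<Sum>j=1..m. fps_of_poly (Q j) * (F oo fps_X ^ (k ^ j)))"
    by (auto simp: mem_mahler_ideal_iff mahler_equation_def)
  have "fps_of_poly (p + q) * F = (\<Sum>j=1..max n m. fps_of_poly
      ((if j \<le> n then P j else 0) + (if j \<le> m then Q j else 0)) * (F oo fps_X ^ (k ^ j)))"
    unfolding fps_of_poly_add distrib_right sum.distrib n(2) m(2)
    by (intro arg_cong2[of _ _ _ _ "(+)"] pad) auto
  then show ?thesis
    using n(1) unfolding mem_mahler_ideal_iff mahler_equation_def
    by (intro exI[of _ "max n m"] conjI
        exI[of _ "\<lambda>j. (if j \<le> n then P j else 0) + (if j \<le> m then Q j else 0)"]) auto
qed

lemma mahler_ideal_mult: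
  assumes "p \<in> mahler_ideal k F"
  shows "r * p \<in> mahler_ideal k F"
proof -
  from assms obtain n P where
    n: "n \<ge> 1" "fps_of_poly p * F = (\<Sum>j=1..n. fps_of_poly (P j) * (F oo fps_X ^ (k ^ j)))"
    by (auto simp: mem_mahler_ideal_iff mahler_equation_def)
  have "fps_of_poly (r * p) * F = (\<Sum>j=1..n. fps_of_poly (r * P j) * (F oo fps_X ^ (k ^ j)))"
    by (simp only: fps_of_poly_mult mult.assoc n(2) sum_distrib_left)
  then show ?thesis
    using n(1) unfolding mem_mahler_ideal_iff mahler_equation_def
    by (intro exI[of _ n] conjI exI[of _ "\<lambda>j. r * P j"]) auto
qed

lemma mahler_denom_ex1:
  fixes F :: "'a::field fps"
  assumes "mahler k F"
  shows "\<exists>!d. mahler_ideal k F = {p. d dvd p} \<and> coeff d (LEAST i. coeff d i \<noteq> 0) = 1"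
proof -
  let ?I = "mahler_ideal k F"
  let ?low = "\<lambda>d::'a poly. coeff d (LEAST i. coeff d i \<noteq> 0)"
  have low_nz: "?low d \<noteq> 0" if "d \<noteq> 0" for d
    using that by (metis (mono_tags, lifting) LeastI leading_coeff_0_iff)
  have low_smult: "?low (smult c d) = c * ?low d" if "c \<noteq> 0" for c d
    using that by simp
  obtain p0 where p0: "p0 \<noteq> 0 \<and> p0 \<in> ?I"
    using assms by (auto simp: mahler_def mem_mahler_ideal_iff)
  define g where "g = arg_min Polynomial.degree (\<lambda>p. p \<noteq> 0 \<and> p \<in> ?I)"
  have g: "g \<noteq> 0" "g \<in> ?I"
    using arg_min_natI[of "\<lambda>p. p \<noteq> 0 \<and> p \<in> ?I", OF p0] unfolding g_def by auto
  have g_min: "Polynomial.degree g \<le> Polynomial.degree p" if "p \<noteq> 0" "p \<in> ?I" for p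
    using that arg_min_nat_le[of "\<lambda>p. p \<noteq> 0 \<and> p \<in> ?I" p] unfolding g_def by auto
  have gen: "?I = {p. g dvd p}"
  proof (intro equalityI subsetI CollectI)
    fix p assume p: "p \<in> ?I"
    have "p mod g = p + (- (p div g)) * g"
      by (simp add: minus_div_mult_eq_mod [symmetric])
    then have "p mod g \<in> ?I"
      using mahler_ideal_add[OF p mahler_ideal_mult[OF g(2)]] by metis
    then have "p mod g = 0"
      using g_min[of "p mod g"] degree_mod_less[OF g(1), of p] by (metis not_less)
    then show "g dvd p" by auto
  next
    fix p assume "p \<in> {p. g dvd p}"
    then show "p \<in> ?I"
      using mahler_ideal_mult[OF g(2)] by (metis dvdE mem_Collect_eq mult.commute)
  qed
  define c where "c = inverse (?low g)"
  have c: "c \<noteq> 0" using low_nz[OF g(1)] by (simp add: c_def)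
  show ?thesis
  proof (rule ex1I[of _ "smult c g"])
    show "?I = {p. smult c g dvd p} \<and> ?low (smult c g) = 1"
      using c low_nz[OF g(1)] unfolding gen low_smult[OF c] by (auto simp: c_def smult_dvd_iff)
  next
    fix d assume d: "?I = {p. d dvd p} \<and> ?low d = 1"
    have "d dvd g" "g dvd d" using d gen by auto
    then obtain u v where uv: "d = g * u" "g = d * v"
      by (auto elim!: dvdE)
    then have "g * (u * v) = g * 1" by (metis mult.assoc mult_1_right)
    then have "u * v = 1" using g(1) mult_left_cancel by blast
    then have "u dvd 1" by (metis dvdI)
    then obtain a0 where "u = [:a0:]" "a0 \<noteq> 0"
      by (auto simp: is_unit_poly_iff dvd_field_iff)
    then obtain a where a: "d = smult a g" "a \<noteq> 0"
      using uv(1) by auto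
    then have "a * ?low g = 1" using d low_smult[OF a(2), of g] by metis
    then have "a = c" unfolding c_def by (metis inverse_unique mult.commute)
    then show "d = smult c g" using a by simp
  qed
qed

end

(*
  Write M for the substitution of x^k. Summing F(z x) over the q-th roots of unity z turns (i) into
  a proportionality between F(x) and F(x^q), modulo the twists F(z x) with z a nontrivial root of
  unity of order dividing a power of q. Hence in a Mahler relation modulo the twists, the
  coefficients may be replaced by their values at x^q.

  Let a be a nonzero root of the Mahler denominator d. By (ii), d does not vanish at z a^(k^s) for
  nontrivial z, so each twist satisfies a Mahler equation whose leading coefficient is nonzero on
  the orbit of a under k-th powers. If a is not a root of unity, then d(x^(q^m)) is also nonzero on
  this orbit for large m. If a is a root of unity of order prime to k, then a relation of minimal
  length is a polynomial times one with constant coefficients, by invariance under x -> x^q. In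
  both cases the twists can be eliminated, which gives a Mahler equation of F whose leading
  coefficient is nonzero at a: a contradiction.

  So all nonzero roots of d are roots of unity whose order is not prime to k. Then d divides
  D(x^k) / D for a suitable polynomial D, and the series Z for which D Z is a combination of the
  M^j F with coefficients of bounded degree form a finite-dimensional space that contains F and is
  stable under taking sections modulo k.
*)

theory Submission
  imports Defs
begin

section \<open>Substitutions and sections\<close>

text \<open>The obstacle is the elimination of the twists. A linear dependence among them costs a
  polynomial factor \<open>D\<close> about which nothing is known, and it may vanish at
  \<open>a\<close>. The system is therefore iterated \<open>r\<close> times before anything is
  eliminated: the loss is then D(x^(k^r)) with \<open>D\<close> independent of \<open>r\<close>,
  besides factors that are nonzero on the orbit of \<open>a\<close>. If \<open>a\<close> is not a
  root of unity, a large \<open>r\<close> moves a^(k^r) away from the roots of \<open>D\<close>. On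
  a periodic orbit no \<open>r\<close> need help; there, relations for different \<open>r\<close>
  are brought to one common factor, which cancels, and a stationarity argument over the local ring
  at \<open>a\<close> supplies the right combination. For a root of unity, passing to x^(q^m) may
  also fail to move the leading coefficient off the orbit. Hence the detour through constant
  coefficients: the only possible zeros are then those of one common polynomial factor, which can be
  absorbed into the series.\<close>

definition fsub :: "'e \<Rightarrow> nat \<Rightarrow> 'e::field fps \<Rightarrow> 'e fps" where
  "fsub c K F = F oo fps_of_poly (monom c K)"

definition psub :: "'e \<Rightarrow> nat \<Rightarrow> 'e::field poly \<Rightarrow> 'e poly" where
  "psub c K p = p \<circ>\<^sub>p monom c K"

text \<open>The section (Cartier) operators. For K = k^e and i < k^e their values at F are the
  members of the k-kernel.\<close>

definition fsec :: "nat \<Rightarrow> nat \<Rightarrow> 'e::zero fps \<Rightarrow> 'e fps" where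
  "fsec K i F = Abs_fps (\<lambda>n. F $ (K * n + i))"

text \<open>The list may stop at \<open>degree p\<close> because K n + i >= n for K > 0, so all
  later entries are 0.\<close>

definition psec :: "nat \<Rightarrow> nat \<Rightarrow> 'e::zero poly \<Rightarrow> 'e poly" where
  "psec K i p = Poly (map (\<lambda>n. coeff p (K * n + i)) [0..<Suc (degree p)])"

lemma fsub_nth:
  assumes "K > 0"
  shows "fsub c K F $ n = (if K dvd n then c ^ (n div K) * F $ (n div K) else 0)"
proof -
  have "fsub c K F $ n = (\<Sum>i=0..n. F $ i * coeff (monom (c ^ i) (K * i)) n)"
    unfolding fsub_def fps_compose_nth fps_of_poly_power [symmetric] monom_power
    by (simp only: fps_of_poly_nth)
  also have "\<dots> = (\<Sum>i=0..n. if i = n div K \<and> K dvd n then F $ i * c ^ i else 0)"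
    using assms by (intro sum.cong) auto
  also have "\<dots> = (if K dvd n then c ^ (n div K) * F $ (n div K) else 0)"
    using assms by (auto simp: sum.delta mult.commute)
  finally show ?thesis .
qed

lemma pcompose_monom: "monom b L \<circ>\<^sub>p q = smult b (q ^ L)"
  for b :: "'e::field"
  by (induction L) (simp_all add: monom_0 monom_Suc pcompose_pCons)

lemma fsub_add: "fsub c K (F + G) = fsub c K F + fsub c K G"
  by (simp add: fsub_def fps_compose_add_distrib)

lemma fsub_0 [simp]: "fsub c K 0 = 0"
  by (simp add: fsub_def)

lemma fsub_sum: "fsub c K (sum f A) = (\<Sum>x\<in>A. fsub c K (f x))"
  by (simp add: fsub_def fps_compose_sum_distrib)

lemma fsub_mult: "K > 0 \<Longrightarrow> fsub c K (F * G) = fsub c K F * fsub c K G"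
  by (simp add: fsub_def fps_compose_mult_distrib)

lemma fsub_of_poly: "K > 0 \<Longrightarrow> fsub c K (fps_of_poly p) = fps_of_poly (psub c K p)"
  by (simp add: fsub_def psub_def fps_of_poly_pcompose)

lemma fsub_const [simp]: "fsub c K (fps_const b) = fps_const b"
  by (simp add: fsub_def)

lemma fsub_fsub:
  assumes "K > 0" "L > 0"
  shows "fsub c K (fsub b L F) = fsub (b * c ^ L) (K * L) F"
proof -
  have "fsub c K (fsub b L F) = F oo (fps_of_poly (monom b L) oo fps_of_poly (monom c K))"
    unfolding fsub_def using assms by (subst fps_compose_assoc) auto
  also have "fps_of_poly (monom b L) oo fps_of_poly (monom c K) =
      fps_of_poly (monom b L \<circ>\<^sub>p monom c K)"
    using assms by (simp add: fps_of_poly_pcompose)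
  also have "monom b L \<circ>\<^sub>p monom c K = monom (b * c ^ L) (K * L)"
    by (simp add: pcompose_monom monom_power smult_monom)
  finally show ?thesis by (simp add: fsub_def)
qed

lemma fsub_1_1 [simp]: "fsub 1 (Suc 0) F = F"
  by (rule fps_ext) (simp add: fsub_nth)

lemma fsub_X_power: "F oo fps_X ^ K = fsub 1 K F"
  by (simp add: fsub_def fps_of_poly_monom)

lemma poly_psub [simp]: "poly (psub c K p) x = poly p (c * x ^ K)"
  by (simp add: psub_def poly_pcompose poly_monom)

lemma psub_mult: "psub c K (p * q) = psub c K p * psub c K q"
  by (simp add: psub_def pcompose_mult)

lemma psub_power: "psub c K (p ^ n) = psub c K p ^ n"
  by (induction n) (simp_all add: psub_mult, simp add: psub_def pcompose_1)

lemma psub_psub: "psub c K (psub b L p) = psub (b * c ^ L) (K * L) p"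
proof -
  have "psub c K (psub b L p) = p \<circ>\<^sub>p (monom b L \<circ>\<^sub>p monom c K)"
    by (simp add: psub_def pcompose_assoc)
  also have "monom b L \<circ>\<^sub>p monom c K = monom (b * c ^ L) (K * L)"
    by (simp add: pcompose_monom monom_power smult_monom)
  finally show ?thesis by (simp add: psub_def)
qed

lemma degree_psub: "c \<noteq> 0 \<Longrightarrow> degree (psub c K p) = degree p * K"
  by (simp add: psub_def degree_pcompose degree_monom_eq)

lemma psub_eq_0_iff: "c \<noteq> 0 \<Longrightarrow> K > 0 \<Longrightarrow> psub c K p = 0 \<longleftrightarrow> p = 0"
  unfolding psub_def by (subst pcompose_eq_0_iff) (auto simp: degree_monom_eq)

lemma psub_monom: "psub 1 K (monom 1 N) = monom 1 (N * K)"
  by (simp add: psub_def pcompose_monom monom_power mult.commute)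

lemma psub_diff: "psub c K (p - q) = psub c K p - psub c K q"
  by (simp add: psub_def pcompose_diff)

lemma psub_1 [simp]: "psub c K 1 = 1"
  by (simp add: psub_def pcompose_1)

lemma psub_1_1 [simp]: "psub 1 (Suc 0) p = p"
  by (simp add: psub_def monom_altdef)

lemma coeff_psec: "K > 0 \<Longrightarrow> coeff (psec K i p) n = coeff p (K * n + i)"
proof (cases "n \<le> degree p")
  case False
  assume "K > 0"
  then have "n \<le> K * n + i" by (simp add: trans_le_add1)
  then have "coeff p (K * n + i) = 0" using False by (intro coeff_eq_0) linarith
  with False show ?thesis by (simp add: psec_def nth_default_def del: upt_Suc)
qed (simp add: psec_def nth_default_def del: upt_Suc)

lemma fsec_of_poly: "K > 0 \<Longrightarrow> fsec K i (fps_of_poly p) = fps_of_poly (psec K i p)"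
  by (rule fps_ext) (simp add: fsec_def coeff_psec)

text \<open>This shrinking of degrees is what keeps a space with bounded coefficient degrees stable
  under sections.\<close>

lemma degree_psec_le:
  assumes "K > 0" shows "K * degree (psec K i p) \<le> degree p"
proof (cases "psec K i p = 0")
  case False
  then have "coeff p (K * degree (psec K i p) + i) \<noteq> 0"
    using coeff_psec[OF assms, of i p] leading_coeff_neq_0 by metis
  then show ?thesis
    using le_degree by fastforce
qed simp

lemma fsec_add: "fsec K i (F + G) = fsec K i F + fsec K i G"
  for F :: "'e::field fps"
  by (rule fps_ext) (simp add: fsec_def)

lemma fsec_sum: "fsec K i (sum f A) = (\<Sum>x\<in>A. fsec K i (f x))"
  for f :: "_ \<Rightarrow> 'e::field fps"
  by (rule fps_ext) (simp add: fsec_def fps_sum_nth)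

lemma fsec_0 [simp]: "fsec K i 0 = 0"
  by (rule fps_ext) (simp add: fsec_def)

text \<open>All exponents of Z(x^K) are divisible by K, so the residue class i of the product only
  sees the residue class i of G: the projection formula for sections.\<close>

lemma fsec_mult_fsub:
  fixes G Z :: "'e::field fps"
  assumes K: "K > 0" and i: "i < K"
  shows "fsec K i (G * fsub 1 K Z) = fsec K i G * Z"
proof (rule fps_ext)
  fix n
  have "(fsub 1 K Z * G) $ (K * n + i) =
      (\<Sum>m=0..K*n+i. fsub 1 K Z $ m * G $ (K * n + i - m))"
    by (simp add: fps_mult_nth)
  also have "\<dots> = (\<Sum>m\<in>(\<lambda>j. K * j) ` {0..n}. fsub 1 K Z $ m * G $ (K * n + i - m))"
  proof (rule sum.mono_neutral_right)
    show "(\<lambda>j. K * j) ` {0..n} \<subseteq> {0..K*n+i}"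
      by (auto intro!: trans_le_add1 mult_le_mono2)
    show "\<forall>m\<in>{0..K*n+i} - (\<lambda>j. K * j) ` {0..n}. fsub 1 K Z $ m * G $ (K * n + i - m) = 0"
    proof
      fix m assume m: "m \<in> {0..K*n+i} - (\<lambda>j. K * j) ` {0..n}"
      have "\<not> K dvd m"
      proof
        assume "K dvd m"
        then obtain j where j: "m = K * j" by auto
        then have "K * j < K * Suc n" using m i by simp
        then have "j \<le> n" using K by (simp only: mult_less_cancel1) simp
        then show False using m j by auto
      qed
      then show "fsub 1 K Z $ m * G $ (K * n + i - m) = 0"
        using K by (simp add: fsub_nth)
    qed
  qed simp
  also have "\<dots> = (\<Sum>j=0..n. fsub 1 K Z $ (K * j) * G $ (K * n + i - K * j))"
    using K by (subst sum.reindex) (auto simp: inj_on_def)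
  also have "\<dots> = (\<Sum>j=0..n. Z $ j * fsec K i G $ (n - j))"
    using K by (intro sum.cong) (auto simp: fsub_nth fsec_def diff_mult_distrib2)
  also have "\<dots> = (Z * fsec K i G) $ n"
    by (simp add: fps_mult_nth)
  finally show "fsec K i (G * fsub 1 K Z) $ n = (fsec K i G * Z) $ n"
    by (simp add: fsec_def mult.commute)
qed

lemma fsec_poly_mult_fsub:
  fixes Z :: "'e::field fps"
  assumes "K > 0" "i < K"
  shows "fsec K i (fps_of_poly p * fsub 1 K Z) = fps_of_poly (psec K i p) * Z"
  using assms by (simp add: fsec_mult_fsub fsec_of_poly)

lemma psec_nonzero:
  assumes "K > 0" "p \<noteq> 0"
  shows "\<exists>i<K. psec K i p \<noteq> 0"
proof -
  obtain n where n: "coeff p n \<noteq> 0" using assms(2) by (meson leading_coeff_neq_0)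
  then have "coeff (psec K (n mod K) p) (n div K) \<noteq> 0"
    using assms(1) by (simp add: coeff_psec)
  then show ?thesis using assms(1) by (intro exI[of _ "n mod K"]) auto
qed

section \<open>Spans over the polynomial ring\<close>

interpretation fpsm: Modules.module "\<lambda>p (F::'e::field fps). fps_of_poly p * F"
  by unfold_locales (simp_all add: fps_of_poly_add fps_of_poly_mult algebra_simps)

declare fpsm.scale_scale [simp del] \<comment> \<open>loops with \<open>fps_of_poly_mult\<close>\<close>

lemma fsub_span:
  assumes "K > 0" "Z \<in> fpsm.span S"
  shows "fsub c K Z \<in> fpsm.span (fsub c K ` S)"
  using assms(2)
proof (induction rule: fpsm.span_induct_alt)
  case base
  show ?case by (simp add: fpsm.span_zero)
next
  case (step p x y)
  then show ?case using assms(1)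
    by (simp add: fsub_add fsub_mult fsub_of_poly fpsm.span_add fpsm.span_scale fpsm.span_base)
qed

lemma fsec_span:
  assumes "K > 0" "i < K" "Z \<in> fpsm.span (fsub 1 K ` S)"
  shows "fsec K i Z \<in> fpsm.span S"
  using assms(3)
proof (induction rule: fpsm.span_induct_alt)
  case base
  show ?case by (simp add: fpsm.span_zero)
next
  case (step p x y)
  then show ?case using assms(1,2)
    by (auto simp: fsec_add fsec_poly_mult_fsub fpsm.span_add fpsm.span_scale fpsm.span_base)
qed

text \<open>Linear independence over the polynomials survives x -> x^K: some section of
  \<open>p\<close> is nonzero, and taking this section undoes the substitution in the whole
  relation.\<close>

lemma span_fsub_independent:
  assumes "K > 0" "p \<noteq> 0" "fps_of_poly p * fsub 1 K b \<in> fpsm.span (fsub 1 K ` S)"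
  shows "\<exists>p'. p' \<noteq> 0 \<and> fps_of_poly p' * b \<in> fpsm.span S"
proof -
  obtain i where "i < K" "psec K i p \<noteq> 0" using psec_nonzero assms by blast
  then show ?thesis
    using fsec_span[OF assms(1) _ assms(3), of i] assms(1) by (auto simp: fsec_poly_mult_fsub)
qed

lemma span_image_sum:
  assumes "finite I" "Z \<in> fpsm.span (g ` I)"
  shows "\<exists>C. Z = (\<Sum>j\<in>I. fps_of_poly (C j) * g j)"
  using assms(2)
proof (induction rule: fpsm.span_induct_alt)
  case base
  show ?case by (intro exI[of _ "\<lambda>_. 0"]) simp
next
  case (step p x y)
  then obtain C j where C: "y = (\<Sum>j\<in>I. fps_of_poly (C j) * g j)" and j: "j \<in> I" "x = g j"
    by auto
  have "fps_of_poly p * x = (\<Sum>i\<in>I. fps_of_poly (if i = j then p else 0) * g i)"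
    using j assms(1) sum.delta[OF assms(1), of j "\<lambda>i. fps_of_poly p * g i"]
    by (simp add: if_distrib[of fps_of_poly] if_distribR if_distrib[of "\<lambda>x. x * _"] cong: if_cong)
  then have "fps_of_poly p * x + y =
      (\<Sum>i\<in>I. fps_of_poly ((if i = j then p else 0) + C i) * g i)"
    unfolding C fps_of_poly_add distrib_right sum.distrib by simp
  then show ?case by (rule exI[of _ "\<lambda>i. (if i = j then p else 0) + C i"])
qed

text \<open>The span after the polynomials in \<open>D\<close> are made invertible. Recording the
  permitted denominators lets the same arguments serve for all nonzero polynomials and for those
  nonvanishing on an orbit.\<close>

definition sat :: "'e::field poly set \<Rightarrow> 'e fps set \<Rightarrow> 'e fps set" where
  "sat D S = {Z. \<exists>Q\<in>D. fps_of_poly Q * Z \<in> fpsm.span S}"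

definition mult_set :: "'e::field poly set \<Rightarrow> bool" where
  "mult_set D \<longleftrightarrow> 1 \<in> D \<and> (\<forall>p\<in>D. \<forall>q\<in>D. p * q \<in> D)"

lemma sat_subspace:
  assumes "mult_set D"
  shows "fpsm.subspace (sat D S)"
proof (rule fpsm.subspaceI)
  show "0 \<in> sat D S"
    using assms by (auto simp: sat_def mult_set_def fpsm.span_zero intro!: bexI[of _ 1])
next
  fix x y assume "x \<in> sat D S" "y \<in> sat D S"
  then obtain P Q where PQ: "P \<in> D" "Q \<in> D" "fps_of_poly P * x \<in> fpsm.span S"
      "fps_of_poly Q * y \<in> fpsm.span S"
    by (auto simp: sat_def)
  have "fps_of_poly (P * Q) * (x + y) =
      fps_of_poly Q * (fps_of_poly P * x) + fps_of_poly P * (fps_of_poly Q * y)"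
    by (simp add: fps_of_poly_mult algebra_simps)
  also have "\<dots> \<in> fpsm.span S"
    by (intro fpsm.span_add fpsm.span_scale PQ(3,4))
  finally show "x + y \<in> sat D S"
    using PQ assms by (auto simp: sat_def mult_set_def)
next
  fix c x assume "x \<in> sat D S"
  then obtain P where P: "P \<in> D" "fps_of_poly P * x \<in> fpsm.span S" by (auto simp: sat_def)
  have "fps_of_poly P * (fps_of_poly c * x) = fps_of_poly c * (fps_of_poly P * x)"
    by (simp add: algebra_simps)
  also have "\<dots> \<in> fpsm.span S" by (rule fpsm.span_scale[OF P(2)])
  finally show "fps_of_poly c * x \<in> sat D S"
    using P by (auto simp: sat_def)
qed

lemma sat_span: "mult_set D \<Longrightarrow> S \<subseteq> sat D T \<Longrightarrow> Z \<in> fpsm.span S \<Longrightarrow> Z \<in> sat D T"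
  using fpsm.span_minimal[OF _ sat_subspace] by blast

lemma span_sat: "mult_set D \<Longrightarrow> Z \<in> fpsm.span S \<Longrightarrow> Z \<in> sat D S"
  by (auto simp: sat_def mult_set_def intro!: bexI[of _ 1])

lemma sat_cancel:
  assumes "mult_set D" "Q \<in> D" "fps_of_poly Q * Z \<in> sat D S"
  shows "Z \<in> sat D S"
proof -
  obtain P where P: "P \<in> D" "fps_of_poly P * (fps_of_poly Q * Z) \<in> fpsm.span S"
    using assms(3) by (auto simp: sat_def)
  then have "fps_of_poly (P * Q) * Z \<in> fpsm.span S"
    by (simp add: fps_of_poly_mult mult.assoc)
  then show ?thesis using P assms by (auto simp: sat_def mult_set_def)
qed

lemma sat_trans:
  assumes "mult_set D" "S \<subseteq> sat D T" "Z \<in> sat D S"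
  shows "Z \<in> sat D T"
proof -
  obtain Q where "Q \<in> D" "fps_of_poly Q * Z \<in> fpsm.span S" using assms(3) unfolding sat_def by blast
  then show ?thesis using sat_cancel[OF assms(1)] sat_span[OF assms(1,2)] by blast
qed

lemma sat_mono: "S \<subseteq> T \<Longrightarrow> sat D S \<subseteq> sat D T"
  unfolding sat_def using fpsm.span_mono[of S T] by blast

lemma sat_fsub:
  assumes "\<And>Q. Q \<in> D \<Longrightarrow> psub 1 K Q \<in> D" "K > 0" "Z \<in> sat D S"
  shows "fsub 1 K Z \<in> sat D (fsub 1 K ` S)"
proof -
  obtain Q where Q: "Q \<in> D" "fps_of_poly Q * Z \<in> fpsm.span S" using assms(3) by (auto simp: sat_def)
  have "fps_of_poly (psub 1 K Q) * fsub 1 K Z \<in> fpsm.span (fsub 1 K ` S)"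
    using fsub_span[OF assms(2) Q(2), of 1] assms(2) by (simp add: fsub_mult fsub_of_poly)
  then show ?thesis using Q assms(1) by (auto simp: sat_def)
qed

lemma sat_finite:
  assumes "Z \<in> sat D S"
  shows "\<exists>T. finite T \<and> T \<subseteq> S \<and> Z \<in> sat D T"
proof -
  obtain Q where Q: "Q \<in> D" "fps_of_poly Q * Z \<in> fpsm.span S" using assms by (auto simp: sat_def)
  then obtain T r where T: "finite T" "T \<subseteq> S" "fps_of_poly Q * Z = (\<Sum>a\<in>T. fps_of_poly (r a) * a)"
    unfolding fpsm.span_explicit by auto
  have "fps_of_poly Q * Z \<in> fpsm.span T"
    unfolding T(3) by (intro fpsm.span_sum fpsm.span_scale fpsm.span_base)
  then have "Z \<in> sat D T" using Q(1) by (auto simp: sat_def)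
  then show ?thesis using T by blast
qed

section \<open>Elimination of the auxiliary series\<close>

text \<open>
  An auxiliary series \<open>b\<close> that depends linearly on the other ones is replaced, at the
  cost of the denominator \<open>D\<close>. An independent one cannot occur, since substitution preserves
  independence.
\<close>

lemma eliminate_finite:
  fixes H :: "'e::field fps"
  assumes k: "k > 0"
    and base: "\<And>r. \<exists>R. R \<noteq> 0 \<and> fps_of_poly R * H \<in> fpsm.span (fsub 1 (k ^ r) ` S)"
    and "finite B"
    and "\<exists>D. D \<noteq> 0 \<and> (\<forall>r. \<exists>Q\<in>\<D>. fps_of_poly (Q * psub 1 (k ^ r) D) * H
      \<in> fpsm.span (fsub 1 (k ^ r) ` (B \<union> S)))"
  shows "\<exists>D. D \<noteq> 0 \<and> (\<forall>r. \<exists>Q\<in>\<D>. fps_of_poly (Q * psub 1 (k ^ r) D) * H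
      \<in> fpsm.span (fsub 1 (k ^ r) ` S))"
  using assms(3,4)
proof (induction B rule: finite_induct)
  case empty
  then show ?case by simp
next
  case (insert b B)
  from insert.prems obtain D where D: "D \<noteq> 0" and
    DQ: "\<And>r. \<exists>Q\<in>\<D>. fps_of_poly (Q * psub 1 (k ^ r) D) * H
      \<in> fpsm.span (insert (fsub 1 (k ^ r) b) (fsub 1 (k ^ r) ` (B \<union> S)))"
    by auto
  show ?case
  proof (cases "\<exists>E. E \<noteq> 0 \<and> fps_of_poly E * b \<in> fpsm.span (B \<union> S)")
    case True
    then obtain E where E: "E \<noteq> 0" "fps_of_poly E * b \<in> fpsm.span (B \<union> S)" by blast
    have "\<exists>Q\<in>\<D>. fps_of_poly (Q * psub 1 (k ^ r) (D * E)) * H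
        \<in> fpsm.span (fsub 1 (k ^ r) ` (B \<union> S))" for r
    proof -
      obtain Q p where Q: "Q \<in> \<D>" "fps_of_poly (Q * psub 1 (k ^ r) D) * H
          - fps_of_poly p * fsub 1 (k ^ r) b \<in> fpsm.span (fsub 1 (k ^ r) ` (B \<union> S))"
        using DQ[of r] unfolding fpsm.span_breakdown_eq by blast
      have "fps_of_poly (psub 1 (k ^ r) E) * fsub 1 (k ^ r) b
          \<in> fpsm.span (fsub 1 (k ^ r) ` (B \<union> S))"
        using fsub_span[OF _ E(2), of "k ^ r" 1] k by (simp add: fsub_mult fsub_of_poly)
      from fpsm.span_add[OF fpsm.span_scale[OF Q(2), of "psub 1 (k ^ r) E"]
          fpsm.span_scale[OF this, of p]]
      show ?thesis using Q(1)
        by (intro bexI[of _ Q]) (simp_all add: psub_mult fps_of_poly_mult algebra_simps)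
    qed
    then show ?thesis using D E by (intro insert.IH exI[of _ "D * E"]) auto
  next
    case False
    have "\<exists>Q\<in>\<D>. fps_of_poly (Q * psub 1 (k ^ r) D) * H
        \<in> fpsm.span (fsub 1 (k ^ r) ` (B \<union> S))" for r
    proof -
      let ?V = "fpsm.span (fsub 1 (k ^ r) ` (B \<union> S))"
      obtain Q p where Q: "Q \<in> \<D>" "fps_of_poly (Q * psub 1 (k ^ r) D) * H
          - fps_of_poly p * fsub 1 (k ^ r) b \<in> ?V"
        using DQ[of r] unfolding fpsm.span_breakdown_eq by blast
      \<comment> \<open>\<open>R\<close> brings \<open>H\<close> itself into the span, which turns
        the relation into one for b(x^(k^r)) alone; its coefficient \<open>R * p\<close> must then
        vanish.\<close>
      obtain R where R: "R \<noteq> 0" "fps_of_poly R * H \<in> fpsm.span (fsub 1 (k ^ r) ` S)"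
        using base by blast
      then have "fps_of_poly R * H \<in> ?V"
        using fpsm.span_mono[of "fsub 1 (k ^ r) ` S" "fsub 1 (k ^ r) ` (B \<union> S)"] by blast
      from fpsm.span_diff[OF fpsm.span_scale[OF this, of "Q * psub 1 (k ^ r) D"]
          fpsm.span_scale[OF Q(2), of R]]
      have "fps_of_poly (R * p) * fsub 1 (k ^ r) b \<in> ?V"
        by (simp add: fps_of_poly_mult algebra_simps)
      then have "R * p = 0"
        using span_fsub_independent[of "k ^ r" "R * p" b "B \<union> S"] k False by auto
      then show ?thesis using Q R by (intro bexI[of _ Q]) auto
    qed
    then show ?thesis using D by (intro insert.IH exI[of _ D]) auto
  qed
qed

definition nonzero_polys :: "'e::field poly set" where
  "nonzero_polys = {p. p \<noteq> 0}"

lemma mult_set_nonzero: "mult_set nonzero_polys"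
  by (auto simp: mult_set_def nonzero_polys_def)

lemma fsub_pow_pow: "k > 0 \<Longrightarrow> fsub 1 (k ^ r) (fsub 1 (k ^ j) H) = fsub 1 (k ^ (r + j)) H"
  by (simp add: fsub_fsub power_add)

text \<open>Any n consecutive iterates suffice to express \<open>H\<close> over the rational
  functions: the lowest one is exchanged for higher ones by the Mahler equation, taken at
  x^(k^r).\<close>

lemma mahler_iterate:
  fixes H :: "'e::field fps"
  assumes k: "k > 0" and d: "d \<noteq> 0" and n: "n \<ge> 1"
    and rel: "fps_of_poly d * H \<in> fpsm.span ((\<lambda>j. fsub 1 (k ^ j) H) ` {1..n})"
  shows "H \<in> sat nonzero_polys ((\<lambda>j. fsub 1 (k ^ (r + j)) H) ` {..<n})"
proof (induction r)
  case 0
  show ?case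
    using n by (intro span_sat[OF mult_set_nonzero] fpsm.span_base)
      (auto intro!: image_eqI[of _ _ 0])
next
  case (Suc r)
  show ?case
  proof (rule sat_trans[OF mult_set_nonzero _ Suc.IH], rule subsetI)
    let ?T = "(\<lambda>j. fsub 1 (k ^ (Suc r + j)) H) ` {..<n}"
    fix x assume "x \<in> (\<lambda>j. fsub 1 (k ^ (r + j)) H) ` {..<n}"
    then obtain j where j: "j < n" "x = fsub 1 (k ^ (r + j)) H" by auto
    show "x \<in> sat nonzero_polys ?T"
    proof (cases j)
      case (Suc i)
      then show ?thesis using j
        by (intro span_sat[OF mult_set_nonzero] fpsm.span_base) (auto intro!: image_eqI[of _ _ i])
    next
      case 0
      have "fsub 1 (k ^ r) (fps_of_poly d * H)
          \<in> fpsm.span (fsub 1 (k ^ r) ` (\<lambda>j. fsub 1 (k ^ j) H) ` {1..n})"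
        using fsub_span[OF _ rel] k by simp
      also have "fsub 1 (k ^ r) ` (\<lambda>j. fsub 1 (k ^ j) H) ` {1..n} = ?T"
        using k unfolding image_Suc_lessThan[symmetric] image_image
        by (simp add: fsub_pow_pow del: power_Suc)
      finally show ?thesis
        using 0 j d k psub_eq_0_iff[of 1 "k ^ r" d] unfolding sat_def nonzero_polys_def
        by (intro CollectI bexI[of _ "psub 1 (k ^ r) d"])
           (auto simp: fsub_mult fsub_of_poly)
    qed
  qed
qed

text \<open>The members of \<open>G\<close> form a column g with g(x) = A(x) g(x^k), the
  denominators of A lying in \<open>\<D>\<close>. Iteration expresses g through g(x^(k^r)) with
  denominators still in \<open>\<D>\<close>. Elimination comes only afterwards, at the level of
  x^(k^r), so the uncontrolled factor appears as D(x^(k^r)).\<close>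

lemma regular_system_elimination:
  fixes H :: "'e::field fps"
  assumes k: "k > 0" and d: "d \<noteq> 0" and n: "n \<ge> 1"
    and rel: "fps_of_poly d * H \<in> fpsm.span ((\<lambda>j. fsub 1 (k ^ j) H) ` {1..n})"
    and \<D>: "mult_set \<D>" "\<And>Q. Q \<in> \<D> \<Longrightarrow> psub 1 k Q \<in> \<D>"
    and G: "finite G" "G \<subseteq> sat \<D> (fsub 1 k ` G)" "H \<in> G"
  shows "\<exists>D. D \<noteq> 0 \<and> (\<forall>r. \<exists>Q\<in>\<D>. fps_of_poly (Q * psub 1 (k ^ r) D) * H
      \<in> fpsm.span ((\<lambda>j. fsub 1 (k ^ (r + j)) H) ` {..<n}))"
proof -
  let ?S = "(\<lambda>j. fsub 1 (k ^ j) H) ` {..<n}"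
  have S: "fsub 1 (k ^ r) ` ?S = (\<lambda>j. fsub 1 (k ^ (r + j)) H) ` {..<n}" for r
    using k by (simp add: image_image fsub_pow_pow)
  have pow: "psub 1 (k ^ r) Q \<in> \<D>" if "Q \<in> \<D>" for r Q
  proof (induction r)
    case (Suc r)
    then show ?case using \<D>(2)[OF Suc] by (simp add: psub_psub)
  qed (use that in simp)
  have iter: "G \<subseteq> sat \<D> (fsub 1 (k ^ r) ` G)" for r
  proof (induction r)
    case 0
    have "fsub 1 (k ^ 0) ` G = G" by simp
    then show ?case using span_sat[OF \<D>(1)] fpsm.span_base by fastforce
  next
    case (Suc r)
    have "fsub 1 (k ^ r) ` G \<subseteq> sat \<D> (fsub 1 (k ^ r) ` fsub 1 k ` G)"
      using sat_fsub[of \<D> "k ^ r", OF pow] G(2) k by fastforce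
    also have "fsub 1 (k ^ r) ` fsub 1 k ` G = fsub 1 (k ^ Suc r) ` G"
      using k by (simp add: image_image fsub_fsub mult.commute)
    finally show ?case using sat_trans[OF \<D>(1) _] Suc.IH by blast
  qed
  have "\<exists>D. D \<noteq> 0 \<and> (\<forall>r. \<exists>Q\<in>\<D>. fps_of_poly (Q * psub 1 (k ^ r) D) * H
      \<in> fpsm.span (fsub 1 (k ^ r) ` ?S))"
  proof (rule eliminate_finite[OF k _ G(1)])
    show "\<exists>R. R \<noteq> 0 \<and> fps_of_poly R * H \<in> fpsm.span (fsub 1 (k ^ r) ` ?S)" for r
      using mahler_iterate[OF k d n rel, of r] unfolding S by (auto simp: sat_def nonzero_polys_def)
    have "\<exists>Q\<in>\<D>. fps_of_poly Q * H \<in> fpsm.span (fsub 1 (k ^ r) ` (G \<union> ?S))" for r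
    proof -
      have "H \<in> sat \<D> (fsub 1 (k ^ r) ` (G \<union> ?S))"
        using iter[of r] G(3) sat_mono[of "fsub 1 (k ^ r) ` G" "fsub 1 (k ^ r) ` (G \<union> ?S)" \<D>]
        by blast
      then show ?thesis by (simp add: sat_def)
    qed
    then show "\<exists>D. D \<noteq> 0 \<and> (\<forall>r. \<exists>Q\<in>\<D>. fps_of_poly (Q * psub 1 (k ^ r) D) * H
      \<in> fpsm.span (fsub 1 (k ^ r) ` (G \<union> ?S)))"
      by (intro exI[of _ 1]) simp
  qed
  then show ?thesis unfolding S .
qed

section \<open>Twists by roots of unity\<close>

lemma power_gcd_eq_1:
  fixes x :: "'e::field"
  assumes "x ^ a = 1" "x ^ b = 1" "a > 0"
  shows "x ^ gcd a b = 1"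
proof -
  obtain u v where "a * u = b * v + gcd a b" using bezout_nat[of a b] assms(3) by auto
  then have "(x ^ a) ^ u = (x ^ b) ^ v * x ^ gcd a b"
    by (simp add: power_add flip: power_mult)
  then show ?thesis using assms by simp
qed

lemma power_coprime_eq_1:
  fixes x :: "'e::field"
  assumes "x ^ a = 1" "x ^ b = 1" "a > 0" "coprime a b"
  shows "x = 1"
  using power_gcd_eq_1[OF assms(1-3)] assms(4) by simp

lemma finite_nth_roots_1: "N > 0 \<Longrightarrow> finite {x::'e::field. x ^ N = 1}"
proof -
  assume "N > 0"
  then have "poly (monom 1 N - 1 :: 'e poly) 0 \<noteq> poly 0 0" by (simp add: poly_monom power_0_left)
  then have "monom 1 N - 1 \<noteq> (0 :: 'e poly)" by metis
  from poly_roots_finite[OF this] show ?thesis by (simp add: poly_monom)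
qed

text \<open>With g = gcd q n and t = q / g, a root y of 1 + x + ... + x^(t-1) has y^t = 1, and y is
  not 1 in characteristic 0. Any g-th root of y serves as \<open>w\<close>.\<close>

lemma exists_nth_root_1:
  assumes "q > 0" "\<not> q dvd n"
  shows "\<exists>w::'e::{alg_closed_field,field_char_0}. w ^ q = 1 \<and> w ^ n \<noteq> 1"
proof -
  define g where "g = gcd q n"
  define t where "t = q div g"
  have q: "q = t * g" by (simp add: t_def g_def)
  have "g > 0" using assms(1) by (simp add: g_def)
  have "t \<noteq> 0" using assms(1) q by (metis mult_0 less_irrefl)
  moreover have "t \<noteq> 1" using assms(2) q by (metis g_def gcd_dvd2 mult_1)
  ultimately have t: "t \<ge> 2" by linarith
  define S :: "'e poly" where "S = (\<Sum>i<t. monom 1 i)"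
  have "coeff S (t - 1) \<noteq> 0"
    using t by (simp add: S_def coeff_sum)
  then have "degree S \<ge> t - 1" by (rule le_degree)
  then obtain y where "poly S y = 0" using alg_closed_imp_poly_has_root[of S] t by fastforce
  then have y: "(\<Sum>i<t. y ^ i) = 0" by (simp add: S_def poly_sum poly_monom)
  have "y ^ t = 1" using y power_diff_1_eq[of y t] by simp
  moreover have "y \<noteq> 1" using y t by auto
  moreover obtain w where w: "w ^ g = y" using nth_root_exists[OF \<open>g > 0\<close>] by blast
  ultimately have "w ^ q = 1" "w ^ g \<noteq> 1"
    unfolding q by (simp_all add: power_mult mult.commute)
  then show ?thesis using power_gcd_eq_1[of w q n] assms(1) g_def by auto
qed

lemma sum_nth_roots_1_power:
  assumes "q > 0"
  shows "(\<Sum>z | z ^ q = 1. z ^ n) =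
    (if q dvd n then of_nat (card {z::'e. z ^ q = 1}) else (0::'e::{alg_closed_field,field_char_0}))"
proof (cases "q dvd n")
  case True
  then obtain m where "n = q * m" by auto
  then show ?thesis by (simp add: power_mult)
next
  case False
  then obtain w :: 'e where w: "w ^ q = 1" "w ^ n \<noteq> 1" using exists_nth_root_1 assms by blast
  then have w0: "w \<noteq> 0" using assms by (auto simp: power_0_left)
  have "bij_betw (\<lambda>z. w * z) {z. z ^ q = 1} {z. z ^ q = 1}"
    using w w0 by (intro bij_betwI[of _ _ _ "\<lambda>z. z / w"]) (auto simp: power_mult_distrib power_divide)
  from sum.reindex_bij_betw[OF this, of "\<lambda>z. z ^ n"]
  have "w ^ n * (\<Sum>z | z ^ q = 1. z ^ n) = (\<Sum>z | z ^ q = 1. z ^ n)"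
    by (simp add: power_mult_distrib sum_distrib_left)
  then have "(w ^ n - 1) * (\<Sum>z | z ^ q = 1. z ^ n) = 0" by (simp add: algebra_simps)
  then show ?thesis using w False by simp
qed

text \<open>The parameter \<open>\<zeta>\<close> makes the formula reach twists in the variable x^q,
  namely by \<open>\<zeta> ^ q\<close>; the value 1 gives the untwisted case.\<close>

lemma sum_root_twists:
  fixes F :: "'e::{alg_closed_field,field_char_0} fps"
  assumes q: "q > 0" and F: "\<And>n. F $ (q * n) = l * F $ n" and L: "L > 0"
  shows "fps_of_poly [:of_nat (card {z::'e. z ^ q = 1}) * l:] * fsub 1 q (fsub (\<zeta> ^ q) L F) =
    (\<Sum>z | z ^ q = 1. fsub (z * \<zeta>) L F)"
proof -
  let ?c = "of_nat (card {z::'e. z ^ q = 1}) * l"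
  have "(\<Sum>z | z ^ q = 1. fsub z 1 F) = fps_const ?c * fsub 1 q F"
  proof (rule fps_ext)
    fix n
    have "(\<Sum>z | z ^ q = 1. fsub z 1 F) $ n = (\<Sum>z | z ^ q = 1. z ^ n) * F $ n"
      by (simp add: fps_sum_nth fsub_nth sum_distrib_right)
    also have "\<dots> = (fps_const ?c * fsub 1 q F) $ n"
      using F q by (auto simp: sum_nth_roots_1_power fsub_nth)
    finally show "(\<Sum>z | z ^ q = 1. fsub z 1 F) $ n = (fps_const ?c * fsub 1 q F) $ n" .
  qed
  then have "fsub \<zeta> L (\<Sum>z | z ^ q = 1. fsub z 1 F) = fsub \<zeta> L (fps_const ?c * fsub 1 q F)"
    by simp
  then show ?thesis
    using q L by (simp add: fsub_sum fsub_mult fsub_fsub fps_of_poly_const mult.commute)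
qed

section \<open>The module spanned by the twists\<close>

definition tors :: "nat \<Rightarrow> nat \<Rightarrow> 'e::field set" where
  "tors q m = {\<eta>. \<eta> \<noteq> 1 \<and> \<eta> ^ (q ^ m) = 1}"

definition twists :: "nat \<Rightarrow> nat \<Rightarrow> 'e::field fps \<Rightarrow> 'e fps set" where
  "twists q k F = {fsub \<eta> (k ^ j) F | \<eta> j. \<exists>m. \<eta> \<in> tors q m}"

lemma finite_tors: "q > 0 \<Longrightarrow> finite (tors q m)"
  by (rule finite_subset[OF _ finite_nth_roots_1[of "q ^ m"]]) (auto simp: tors_def)

lemma tors_mono: "m \<le> n \<Longrightarrow> tors q m \<subseteq> tors q n"
  by (auto simp: tors_def le_iff_add power_add power_mult)

text \<open>An element killed by both \<open>q ^ m\<close> and a power of \<open>k\<close> is 1,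
  these numbers being coprime. So the Mahler equation of a twist involves only twists of the same
  finite level \<open>m\<close>.\<close>

lemma tors_power:
  assumes "\<eta> \<in> tors q m" "coprime q k" "q > 0"
  shows "\<eta> ^ (k ^ j) \<in> tors q m"
proof -
  have "(\<eta> ^ (k ^ j)) ^ (q ^ m) = (\<eta> ^ (q ^ m)) ^ (k ^ j)"
    by (simp add: mult.commute flip: power_mult)
  moreover have "\<eta> ^ (k ^ j) \<noteq> 1"
    using assms power_coprime_eq_1[of \<eta> "q ^ m" "k ^ j"] by (auto simp: tors_def)
  ultimately show ?thesis using assms by (simp add: tors_def)
qed

locale q_multiplicative =
  fixes F :: "'e::{alg_closed_field,field_char_0} fps" and k q :: nat and l :: 'e
  assumes k: "k \<ge> 2" and q: "q \<ge> 2" and coprime_qk: "coprime q k"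
    and q_mult: "\<And>n. F $ (q * n) = l * F $ n"
begin

abbreviation "NN \<equiv> fpsm.span (twists q k F)"

lemma k_pos: "k > 0" and q_pos: "q > 0" using k q by auto

lemma root_twist_in_twists:
  assumes "\<zeta> ^ q \<in> tors q m" "z ^ q = 1"
  shows "fsub (z * \<zeta>) (k ^ j) F \<in> twists q k F"
proof -
  have *: "(z * \<zeta>) ^ q = \<zeta> ^ q" using assms by (simp add: power_mult_distrib)
  then have "(z * \<zeta>) ^ (q ^ Suc m) = (\<zeta> ^ q) ^ (q ^ m)" by (simp only: power_Suc power_mult)
  moreover have "z * \<zeta> \<noteq> 1" using * assms(1) by (metis (no_types, lifting) power_one tors_def mem_Collect_eq)
  ultimately have "z * \<zeta> \<in> tors q (Suc m)" using assms(1) by (simp add: tors_def)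
  then show ?thesis unfolding twists_def by blast
qed

text \<open>A constant, written as a polynomial because the scalars of \<open>fpsm\<close> are
  polynomials.\<close>

definition c0 :: "'e poly" where "c0 = [:of_nat (card {z::'e. z ^ q = 1}) * l:]"

lemma twists_fsub_q:
  assumes "Z \<in> NN"
  shows "fps_of_poly c0 * fsub 1 q Z \<in> NN"
  using assms
proof (induction rule: fpsm.span_induct_alt)
  case base
  show ?case by (simp add: fpsm.span_zero)
next
  case (step p x y)
  obtain \<eta> j m where x: "x = fsub \<eta> (k ^ j) F" "\<eta> \<in> tors q m" using step by (auto simp: twists_def)
  obtain \<zeta> where \<zeta>: "\<zeta> ^ q = \<eta>" using nth_root_exists q_pos by blast
  have "fps_of_poly c0 * fsub 1 q x = (\<Sum>z | z ^ q = 1. fsub (z * \<zeta>) (k ^ j) F)"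
    using sum_root_twists[OF q_pos q_mult, of "k ^ j" \<zeta>] k_pos x \<zeta> by (simp add: c0_def)
  also have "\<dots> \<in> NN"
    using x \<zeta> by (intro fpsm.span_sum fpsm.span_base root_twist_in_twists) auto
  finally have "fps_of_poly c0 * fsub 1 q x \<in> NN" .
  from fpsm.span_add[OF fpsm.span_scale[OF this, of "psub 1 q p"] step.IH]
  have "fps_of_poly (psub 1 q p) * (fps_of_poly c0 * fsub 1 q x) + fps_of_poly c0 * fsub 1 q y \<in> NN" .
  also have "fps_of_poly (psub 1 q p) * (fps_of_poly c0 * fsub 1 q x) + fps_of_poly c0 * fsub 1 q y =
      fps_of_poly c0 * fsub 1 q (fps_of_poly p * x + y)"
    using q_pos by (simp add: fsub_add fsub_mult fsub_of_poly algebra_simps)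
  finally show ?case .
qed

lemma untwisted_fsub_q:
  "fps_of_poly c0 * fsub 1 q (fsub 1 (k ^ j) F) - fsub 1 (k ^ j) F \<in> NN"
proof -
  have fin: "finite {z::'e. z ^ q = 1}" using finite_nth_roots_1 q_pos by blast
  have "fps_of_poly c0 * fsub 1 q (fsub 1 (k ^ j) F) = (\<Sum>z | z ^ q = 1. fsub z (k ^ j) F)"
    using sum_root_twists[OF q_pos q_mult, of "k ^ j" 1] k_pos by (simp add: c0_def)
  also have "\<dots> = fsub 1 (k ^ j) F + (\<Sum>z\<in>{z. z ^ q = 1} - {1}. fsub z (k ^ j) F)"
    using fin by (subst sum.remove[of _ 1]) auto
  finally have "fps_of_poly c0 * fsub 1 q (fsub 1 (k ^ j) F) - fsub 1 (k ^ j) F =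
      (\<Sum>z\<in>{z. z ^ q = 1} - {1}. fsub z (k ^ j) F)" by simp
  also have "\<dots> \<in> NN"
  proof (intro fpsm.span_sum fpsm.span_base)
    fix z :: 'e assume "z \<in> {z. z ^ q = 1} - {1}"
    then have "z \<in> tors q 1" by (simp add: tors_def)
    then show "fsub z (k ^ j) F \<in> twists q k F" unfolding twists_def by blast
  qed
  finally show ?thesis .
qed

text \<open>
  Summing \<open>F(z x)\<close> over the \<open>q\<close>-th roots of unity \<open>z\<close> gives a multiple of \<open>F(x\<^sup>q)\<close>.
  So modulo the twists, \<open>F(x)\<close> and a constant multiple of \<open>F(x\<^sup>q)\<close> agree, and the coefficients
  of a relation may be replaced by their values at \<open>x\<^sup>q\<close>.
\<close>

lemma relation_fsub_q:
  assumes "(\<Sum>j\<in>A. fps_of_poly (P j) * fsub 1 (k ^ j) F) \<in> NN"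
  shows "(\<Sum>j\<in>A. fps_of_poly (psub 1 q (P j)) * fsub 1 (k ^ j) F) \<in> NN"
proof -
  have "(\<Sum>j\<in>A. fps_of_poly (psub 1 q (P j)) *
      (fps_of_poly c0 * fsub 1 q (fsub 1 (k ^ j) F) - fsub 1 (k ^ j) F)) \<in> NN"
    by (intro fpsm.span_sum fpsm.span_scale untwisted_fsub_q)
  from fpsm.span_diff[OF twists_fsub_q[OF assms] this]
  show ?thesis
    using q_pos by (simp add: fsub_sum fsub_mult fsub_of_poly sum_distrib_left algebra_simps sum_subtractf)
qed

lemma relation_fsub_q_pow:
  assumes "(\<Sum>j\<in>A. fps_of_poly (P j) * fsub 1 (k ^ j) F) \<in> NN"
  shows "(\<Sum>j\<in>A. fps_of_poly (psub 1 (q ^ m) (P j)) * fsub 1 (k ^ j) F) \<in> NN"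
proof (induction m)
  case 0
  then show ?case using assms by simp
next
  case (Suc m)
  from relation_fsub_q[OF Suc] show ?case by (simp add: psub_psub)
qed

text \<open>Substituting \<open>\<eta>\<close> x in the Mahler equation gives one for the twist,
  with leading coefficient d(\<open>\<eta>\<close> x). The series on its right have exponent j >= 1,
  so they arise by x -> x^k from twists with exponent j - 1; hence the bound
  \<open>j < n\<close>.\<close>

lemma twist_saturated:
  assumes rel: "fps_of_poly d * F = (\<Sum>j=1..n. fps_of_poly (P j) * fsub 1 (k ^ j) F)"
    and \<D>: "mult_set \<D>" and \<eta>: "\<eta> \<in> tors q m" and d: "psub \<eta> 1 d \<in> \<D>"
    and sub: "\<And>\<theta> j. \<theta> \<in> tors q m \<Longrightarrow> j < n \<Longrightarrow> fsub \<theta> (k ^ j) F \<in> G"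
  shows "fsub \<eta> 1 F \<in> sat \<D> (fsub 1 k ` G)"
proof (rule sat_cancel[OF \<D> d], rule span_sat[OF \<D>])
  have "fps_of_poly (psub \<eta> 1 d) * fsub \<eta> 1 F = fsub \<eta> 1 (fps_of_poly d * F)"
    by (simp add: fsub_mult fsub_of_poly)
  also have "\<dots> = (\<Sum>j=1..n. fps_of_poly (psub \<eta> 1 (P j)) * fsub (\<eta> ^ (k ^ j)) (k ^ j) F)"
    unfolding rel using k_pos by (simp add: fsub_sum fsub_mult fsub_of_poly fsub_fsub)
  also have "\<dots> \<in> fpsm.span (fsub 1 k ` G)"
  proof (intro fpsm.span_sum fpsm.span_scale fpsm.span_base)
    fix j assume j: "j \<in> {1..n}"
    have "fsub (\<eta> ^ (k ^ j)) (k ^ (j - 1)) F \<in> G"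
      using tors_power[OF \<eta> coprime_qk q_pos] j by (intro sub) auto
    moreover have "fsub 1 k (fsub (\<eta> ^ (k ^ j)) (k ^ (j - 1)) F) = fsub (\<eta> ^ (k ^ j)) (k ^ j) F"
      using j k_pos by (cases j) (simp_all add: fsub_fsub)
    ultimately show "fsub (\<eta> ^ (k ^ j)) (k ^ j) F \<in> fsub 1 k ` G" by (metis imageI)
  qed
  finally show "fps_of_poly (psub \<eta> 1 d) * fsub \<eta> 1 F \<in> fpsm.span (fsub 1 k ` G)" .
qed

text \<open>Only finitely many iterates and twists occur in the expression of \<open>H\<close>. Let
  \<open>G n\<close> contain everything up to level and exponent \<open>n\<close>: a member with
  positive exponent is a substitution of another member, a twist with exponent 0 has its own Mahler
  equation, and \<open>H\<close> is covered by the premise.\<close>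

lemma exists_regular_system:
  assumes rel: "fps_of_poly d * F = (\<Sum>j=1..n0. fps_of_poly (P j) * fsub 1 (k ^ j) F)"
    and \<D>: "mult_set \<D>" and d: "\<And>\<eta> m. \<eta> \<in> tors q m \<Longrightarrow> psub \<eta> 1 d \<in> \<D>"
    and H: "H \<in> sat \<D> ({fsub 1 (k ^ j) H |j. j \<ge> 1} \<union> twists q k F)"
  shows "\<exists>G. finite G \<and> H \<in> G \<and> G \<subseteq> sat \<D> (fsub 1 k ` G)"
proof -
  \<comment> \<open>The bound is n + 1 because x -> x^k raises the exponents in \<open>G n\<close>
    by one.\<close>
  define Y where "Y n = {fsub 1 (k ^ j) H |j. 1 \<le> j \<and> j \<le> n + 1} \<union>
    {fsub \<eta> (k ^ j) F |\<eta> j. \<eta> \<in> tors q n \<and> j \<le> n + 1}" for n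
  define G where "G n = {fsub 1 (k ^ j) H |j. j \<le> n} \<union>
    {fsub \<eta> (k ^ j) F |\<eta> j. \<eta> \<in> tors q n \<and> j \<le> n}" for n
  have Y_mono: "Y m \<subseteq> Y n" if "m \<le> n" for m n
    using that tors_mono[OF that, of q] unfolding Y_def by fastforce
  have "\<exists>n\<ge>n0. T \<subseteq> Y n" if "finite T" "T \<subseteq> {fsub 1 (k ^ j) H |j. j \<ge> 1} \<union> twists q k F" for T
    using that
  proof (induction T rule: finite_induct)
    case (insert x T)
    then obtain n where n: "n \<ge> n0" "T \<subseteq> Y n" by auto
    have "\<exists>m. x \<in> Y m"
    proof (cases "x \<in> twists q k F")
      case True
      then obtain \<eta> j m where x: "x = fsub \<eta> (k ^ j) F" "\<eta> \<in> tors q m" by (auto simp: twists_def)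
      then have "x \<in> Y (max j m)"
        using tors_mono[of m "max j m" q] unfolding Y_def by fastforce
      then show ?thesis ..
    next
      case False
      then obtain j where "x = fsub 1 (k ^ j) H" "j \<ge> 1" using insert by auto
      then have "x \<in> Y j" by (auto simp: Y_def)
      then show ?thesis ..
    qed
    then obtain m where "x \<in> Y m" ..
    then have "insert x T \<subseteq> Y (max m n)" using n Y_mono[of m "max m n"] Y_mono[of n "max m n"] by auto
    then show ?case using n by (intro exI[of _ "max m n"]) auto
  qed auto
  moreover obtain T where T: "finite T" "T \<subseteq> {fsub 1 (k ^ j) H |j. j \<ge> 1} \<union> twists q k F"
    "H \<in> sat \<D> T" using sat_finite[OF H] by blast
  ultimately obtain n where n: "n \<ge> n0" "T \<subseteq> Y n" by blast
  have fsub_G: "fsub 1 k x \<in> sat \<D> (fsub 1 k ` G n)" if "x \<in> G n" for x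
    using that by (intro span_sat[OF \<D>] fpsm.span_base imageI)
  have Y_sat: "Y n \<subseteq> sat \<D> (fsub 1 k ` G n)"
  proof
    fix x assume "x \<in> Y n"
    then consider j where "x = fsub 1 (k ^ j) H" "1 \<le> j" "j \<le> n + 1"
      | \<eta> j where "x = fsub \<eta> (k ^ j) F" "\<eta> \<in> tors q n" "j \<le> n + 1"
      unfolding Y_def by blast
    then show "x \<in> sat \<D> (fsub 1 k ` G n)"
    proof cases
      case 1
      then obtain i where i: "j = Suc i" "i \<le> n" by (cases j) auto
      then have "fsub 1 (k ^ i) H \<in> G n" by (auto simp: G_def)
      from fsub_G[OF this] show ?thesis using 1 i k_pos by (simp add: fsub_fsub)
    next
      case 2
      show ?thesis
      proof (cases j)
        case (Suc i)
        then have "fsub \<eta> (k ^ i) F \<in> G n" using 2 unfolding G_def by auto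
        from fsub_G[OF this] show ?thesis using 2 Suc k_pos by (simp add: fsub_fsub)
      next
        case 0
        have "fsub \<theta> (k ^ i) F \<in> G n" if "\<theta> \<in> tors q n" "i < n0" for \<theta> i
        proof -
          have "i \<le> n" using that n by simp
          then show ?thesis using that(1) unfolding G_def by blast
        qed
        from twist_saturated[OF rel \<D> 2(2) d[OF 2(2)] this] show ?thesis using 0 2(1) by simp
      qed
    qed
  qed
  have "G n \<subseteq> insert H (Y n)"
  proof
    fix x assume "x \<in> G n"
    then consider j where "x = fsub 1 (k ^ j) H" "j \<le> n" | "x \<in> Y n"
      unfolding G_def Y_def by fastforce
    then show "x \<in> insert H (Y n)"
    proof cases
      case 1
      then show ?thesis
      proof (cases "j = 0")
        case False
        then have "1 \<le> j" "j \<le> n + 1" using 1 by auto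
        then show ?thesis using 1 unfolding Y_def by blast
      qed simp
    qed simp
  qed
  moreover have "H \<in> sat \<D> (fsub 1 k ` G n)"
    using sat_trans[OF \<D> _ T(3)] n(2) Y_sat by blast
  ultimately have "G n \<subseteq> sat \<D> (fsub 1 k ` G n)" using Y_sat by blast
  moreover have "finite (G n)"
  proof -
    have "G n = (\<lambda>j. fsub 1 (k ^ j) H) ` {..n} \<union> (\<lambda>(\<eta>, j). fsub \<eta> (k ^ j) F) ` (tors q n \<times> {..n})"
      by (auto simp: G_def)
    then show ?thesis
      by (simp only:) (intro finite_UnI finite_imageI finite_cartesian_product finite_tors q_pos finite_atMost)
  qed
  moreover have "H \<in> G n" by (auto simp: G_def intro!: exI[of _ 0])
  ultimately show ?thesis by blast
qed

end

section \<open>Rows of polynomials at a periodic point\<close>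

lemma psub_sum: "psub c K (sum f A) = (\<Sum>x\<in>A. psub c K (f x))"
  by (simp add: psub_def pcompose_sum)

lemma sum_lessThan_add: "(\<Sum>i<m+n. f i) = (\<Sum>i<m. f i) + (\<Sum>i<n. f (m + i))"
  for f :: "nat \<Rightarrow> 'b::comm_monoid_add"
  by (induction n) (simp_all add: add.assoc)

text \<open>\<open>a\<close> is a simple root of x^K - a: the derivative there is K a^(K-1), nonzero
  in characteristic 0, and it equals the value of the cofactor \<open>h\<close> at
  \<open>a\<close>.\<close>

lemma psub_linear_factor:
  fixes a :: "'e::field_char_0"
  assumes "a \<noteq> 0" "K > 0" "a ^ K = a"
  shows "\<exists>h. psub 1 K [:-a, 1:] = [:-a, 1:] * h \<and> poly h a \<noteq> 0"
proof -
  have eq: "psub 1 K [:-a, 1:] = monom 1 K - [:a:]"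
    by (simp add: psub_def pcompose_pCons)
  have "poly (psub 1 K [:-a, 1:]) a = 0" using assms by simp
  then obtain h where h: "psub 1 K [:-a, 1:] = [:-a, 1:] * h"
    unfolding poly_eq_0_iff_dvd by (elim dvdE)
  have "poly (pderiv (psub 1 K [:-a, 1:])) a = poly h a"
    unfolding h pderiv_mult by (simp add: pderiv_pCons)
  moreover have "poly (pderiv (psub 1 K [:-a, 1:])) a = of_nat K * a ^ (K - 1)"
    unfolding eq by (simp add: pderiv_diff pderiv_monom poly_monom pderiv_pCons)
  ultimately show ?thesis using assms h by auto
qed

lemma psub_factor_order:
  fixes a :: "'e::field_char_0"
  assumes "a \<noteq> 0" "K > 0" "a ^ K = a" "p \<noteq> 0"
  shows "\<exists>u. psub 1 K p = [:-a, 1:] ^ order a p * u \<and> poly u a \<noteq> 0"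
proof -
  obtain h where h: "psub 1 K [:-a, 1:] = [:-a, 1:] * h" "poly h a \<noteq> 0"
    using psub_linear_factor assms by blast
  obtain v where v: "p = [:-a, 1:] ^ order a p * v" "\<not> [:-a, 1:] dvd v"
    using order_decomp[OF assms(4)] by blast
  have "psub 1 K p = (psub 1 K [:-a, 1:]) ^ order a p * psub 1 K v"
    by (subst v(1)) (simp add: psub_mult psub_power)
  also have "\<dots> = [:-a, 1:] ^ order a p * (h ^ order a p * psub 1 K v)"
    unfolding h by (simp only: power_mult_distrib mult.assoc)
  finally have "psub 1 K p = [:-a, 1:] ^ order a p * (h ^ order a p * psub 1 K v)" .
  moreover have "poly (h ^ order a p * psub 1 K v) a \<noteq> 0"
    using h(2) v(2) assms(3) unfolding poly_eq_0_iff_dvd[symmetric] by simp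
  ultimately show ?thesis by blast
qed

text \<open>
  Over the local ring at \<open>a\<close>, the substitution \<open>x \<mapsto> x\<^sup>K\<close> preserves orders of vanishing at the
  fixed point \<open>a\<close>, so the increasing modules generated by the rows and their substitutions
  become stationary.
\<close>

lemma rows_stationary:
  fixes c :: "nat \<Rightarrow> nat \<Rightarrow> 'e::field_char_0 poly"
  assumes a: "a \<noteq> 0" "a ^ K = a" and K: "K > 0"
  shows "\<exists>J \<gamma> \<beta>. poly \<gamma> a \<noteq> 0 \<and>
    (\<forall>j<n. \<gamma> * c J j = (\<Sum>i<J. \<beta> i * psub 1 (K ^ (J - i)) (c i j)))"
proof (induction n arbitrary: c)
  case 0
  show ?case by (intro exI[of _ 0] exI[of _ 1]) simp
next
  case (Suc n)
  have aK: "a ^ (K ^ i) = a" for i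
  proof (induction i)
    case (Suc i)
    have "a ^ (K ^ Suc i) = (a ^ (K ^ i)) ^ K" by (simp add: mult.commute flip: power_mult)
    then show ?case using Suc a by simp
  qed simp
  show ?case
  proof (cases "\<forall>i. c i n = 0")
    case True
    obtain J \<gamma> \<beta> where *: "poly \<gamma> a \<noteq> 0"
      "\<And>j. j < n \<Longrightarrow> \<gamma> * c J j = (\<Sum>i<J. \<beta> i * psub 1 (K ^ (J - i)) (c i j))"
      using Suc[of c] by blast
    have "\<gamma> * c J j = (\<Sum>i<J. \<beta> i * psub 1 (K ^ (J - i)) (c i j))" if "j < Suc n" for j
      using that * True by (cases "j = n") (auto simp: psub_def)
    then show ?thesis using *(1) by blast
  next
    case False
    then obtain i0 where i0: "c i0 n \<noteq> 0" by blast
    \<comment> \<open>The elements of the J-th module: combinations of the rows up to J, each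
      carried to level J by substitution.\<close>
    define W where "W J \<beta> j = (\<Sum>i\<le>J. \<beta> i * psub 1 (K ^ (J - i)) (c i j))" for J \<beta> j
    have W_unit: "W J (\<lambda>i. if i = J then 1 else 0) j = c J j" for J j
    proof -
      have "W J (\<lambda>i. if i = J then 1 else 0) j =
          (\<Sum>i\<le>J. if i = J then psub 1 (K ^ (J - i)) (c i j) else 0)"
        unfolding W_def by (intro sum.cong) auto
      then show ?thesis by simp
    qed
    define good where "good x \<longleftrightarrow> W (fst x) (snd x) n \<noteq> 0" for x
    \<comment> \<open>The pivot: among all levels and all combinations, one whose last entry is
      nonzero and has the least order at \<open>a\<close>.\<close>
    define x where "x = arg_min (\<lambda>x. order a (W (fst x) (snd x) n)) good"
    have "good (i0, \<lambda>i. if i = i0 then 1 else 0)" using i0 by (simp add: good_def W_unit)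
    from arg_min_nat_lemma[of good, OF this, of "\<lambda>x. order a (W (fst x) (snd x) n)"]
    have x: "good x" "\<And>y. good y \<Longrightarrow> order a (W (fst x) (snd x) n) \<le> order a (W (fst y) (snd y) n)"
      unfolding x_def by auto
    define J0 where "J0 = fst x"
    define \<beta>0 where "\<beta>0 = snd x"
    define w where "w = W J0 \<beta>0"
    define m where "m = order a (w n)"
    have w0: "w n \<noteq> 0" using x(1) by (simp add: good_def w_def J0_def \<beta>0_def)
    have "[:-a, 1:] ^ m dvd c J n" for J
    proof (cases "c J n = 0")
      case False
      then have "good (J, \<lambda>i. if i = J then 1 else 0)" by (simp add: good_def W_unit)
      from x(2)[OF this] have "m \<le> order a (c J n)"
        by (simp add: W_unit m_def w_def J0_def \<beta>0_def)
      then show ?thesis using order_divides by blast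
    qed simp
    then have "\<exists>p. c J n = [:-a, 1:] ^ m * p" for J by (auto elim: dvdE)
    then obtain p where p: "\<And>J. c J n = [:-a, 1:] ^ m * p J" by metis
    have "\<exists>u. psub 1 (K ^ i) (w n) = [:-a, 1:] ^ m * u \<and> poly u a \<noteq> 0" for i
      unfolding m_def using a K w0 aK by (intro psub_factor_order) auto
    then obtain u where u: "\<And>i. psub 1 (K ^ i) (w n) = [:-a, 1:] ^ m * u i" "\<And>i. poly (u i) a \<noteq> 0"
      by metis
    \<comment> \<open>The pivot, carried from level \<open>J0\<close> to level
      \<open>Suc J0 + i\<close>, clears the last column there. It still has order \<open>m\<close>
      in this column, so the multiplier \<open>u (Suc i)\<close> of the row is nonzero at
      \<open>a\<close>.\<close>
    define c' where "c' i j = u (Suc i) * c (Suc J0 + i) j - p (Suc J0 + i) * psub 1 (K ^ Suc i) (w j)" for i j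
    have c'n: "c' i n = 0" for i
      unfolding c'_def u(1) p by (simp add: algebra_simps)
    obtain J \<gamma> \<beta> where IH: "poly \<gamma> a \<noteq> 0"
      "\<And>j. j < n \<Longrightarrow> \<gamma> * c' J j = (\<Sum>i<J. \<beta> i * psub 1 (K ^ (J - i)) (c' i j))"
      using Suc[of c'] by blast
    have IH': "\<gamma> * c' J j = (\<Sum>i<J. \<beta> i * psub 1 (K ^ (J - i)) (c' i j))" if "j < Suc n" for j
      using that IH c'n by (cases "j = n") (auto simp: psub_def)
    \<comment> \<open>\<open>\<kappa>\<close> collects the multiples of the pivot that appear when
      the relation for \<open>c'\<close> is rewritten for \<open>c\<close>; expanding the pivot
      fills the indices up to \<open>J0\<close>.\<close>
    define \<kappa> where "\<kappa> = \<gamma> * p (Suc J0 + J) - (\<Sum>i<J. \<beta> i * psub 1 (K ^ (J - i)) (p (Suc J0 + i)))"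
    define \<beta>' where "\<beta>' i = (if i < Suc J0 then \<kappa> * psub 1 (K ^ Suc J) (\<beta>0 i)
      else \<beta> (i - Suc J0) * psub 1 (K ^ (J - (i - Suc J0))) (u (Suc (i - Suc J0))))" for i
    have "(\<gamma> * u (Suc J)) * c (Suc J0 + J) j =
        (\<Sum>i<Suc J0 + J. \<beta>' i * psub 1 (K ^ (Suc J0 + J - i)) (c i j))" if j: "j < Suc n" for j
    proof -
      let ?w = "psub 1 (K ^ Suc J) (w j)"
      have psub_c': "psub 1 (K ^ (J - i)) (c' i j) =
          psub 1 (K ^ (J - i)) (u (Suc i)) * psub 1 (K ^ (J - i)) (c (Suc J0 + i) j)
          - psub 1 (K ^ (J - i)) (p (Suc J0 + i)) * ?w" if "i < J" for i
      proof -
        have "K ^ (J - i) * K ^ Suc i = K ^ Suc J"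
          using that by (simp flip: power_add del: power_Suc)
        then show ?thesis
          unfolding c'_def psub_diff psub_mult psub_psub by (simp del: power_Suc)
      qed
      have "\<gamma> * c' J j = (\<Sum>i<J. \<beta> i * (psub 1 (K ^ (J - i)) (u (Suc i)) *
          psub 1 (K ^ (J - i)) (c (Suc J0 + i) j))
          - \<beta> i * psub 1 (K ^ (J - i)) (p (Suc J0 + i)) * ?w)"
        unfolding IH'[OF j] 
        by (intro sum.cong refl) (simp only: psub_c' lessThan_iff right_diff_distrib mult.assoc)
      also have "\<dots> = (\<Sum>i<J. \<beta> i * (psub 1 (K ^ (J - i)) (u (Suc i)) *
          psub 1 (K ^ (J - i)) (c (Suc J0 + i) j)))
          - (\<Sum>i<J. \<beta> i * psub 1 (K ^ (J - i)) (p (Suc J0 + i))) * ?w"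
        by (simp only: sum_subtractf sum_distrib_right)
      finally have 1: "\<gamma> * u (Suc J) * c (Suc J0 + J) j =
          (\<Sum>i<J. \<beta> i * psub 1 (K ^ (J - i)) (u (Suc i)) * psub 1 (K ^ (J - i)) (c (Suc J0 + i) j))
          + \<kappa> * ?w"
        unfolding c'_def[of J] \<kappa>_def by (simp add: algebra_simps)
      have w_eq: "?w = (\<Sum>i<Suc J0. psub 1 (K ^ Suc J) (\<beta>0 i) * psub 1 (K ^ (Suc J0 + J - i)) (c i j))"
        unfolding w_def W_def psub_sum lessThan_Suc_atMost
      proof (intro sum.cong refl)
        fix i assume "i \<in> {..J0}"
        then have "K ^ Suc J * K ^ (J0 - i) = K ^ (Suc J0 + J - i)"
          by (simp add: Suc_diff_le add.commute flip: power_add del: power_Suc)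
        then show "psub 1 (K ^ Suc J) (\<beta>0 i * psub 1 (K ^ (J0 - i)) (c i j)) =
            psub 1 (K ^ Suc J) (\<beta>0 i) * psub 1 (K ^ (Suc J0 + J - i)) (c i j)"
          unfolding psub_mult psub_psub by (simp del: power_Suc)
      qed
      have 2: "\<kappa> * ?w = (\<Sum>i<Suc J0. \<beta>' i * psub 1 (K ^ (Suc J0 + J - i)) (c i j))"
        unfolding w_eq sum_distrib_left
        by (intro sum.cong refl) (simp add: \<beta>'_def mult.assoc del: power_Suc)
      show ?thesis
        unfolding 1 2 sum_lessThan_add by (simp add: \<beta>'_def)
    qed
    moreover have "poly (\<gamma> * u (Suc J)) a \<noteq> 0" using IH u by simp
    ultimately show ?thesis by blast
  qed
qed

section \<open>Roots of the denominator\<close>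

text \<open>A / B is invariant under x -> x^q. Comparison of degrees shows that every nonzero
  solution has the degree of B; subtracting the multiple of B that cancels the coefficient at this
  degree leaves a solution that must be 0.\<close>

lemma psub_ratio_const:
  fixes A B :: "'e::field poly"
  assumes q: "q \<ge> 2" and B: "B \<noteq> 0" and eq: "psub 1 q B * A = B * psub 1 q A"
  shows "\<exists>c. A = smult c B"
proof -
  have deg: "degree C = degree B" if C: "C \<noteq> 0" and eqC: "psub 1 q B * C = B * psub 1 q C" for C
  proof -
    have nz: "psub 1 q B \<noteq> 0" "psub 1 q C \<noteq> 0" using q B C by (simp_all add: psub_eq_0_iff)
    have "degree (psub 1 q B * C) = degree (B * psub 1 q C)" using eqC by simp
    then have "degree B * q + degree C = degree B + degree C * q"
      using nz B C by (simp add: degree_mult_eq degree_psub)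
    moreover obtain p where "q = Suc (Suc p)" using q by (metis add_2_eq_Suc le_Suc_ex)
    ultimately have "degree B * Suc p = degree C * Suc p" by simp
    then show ?thesis by (simp only: mult_cancel2) auto
  qed
  define c where "c = coeff A (degree B) / lead_coeff B"
  have "psub 1 q B * (A - smult c B) = B * psub 1 q (A - smult c B)"
  proof -
    have "psub 1 q (smult c B) = smult c (psub 1 q B)" by (simp add: psub_def pcompose_smult)
    then show ?thesis using eq by (simp add: psub_diff algebra_simps)
  qed
  moreover have "coeff (A - smult c B) (degree B) = 0" using B by (simp add: c_def)
  ultimately have "A - smult c B = 0"
    using deg[of "A - smult c B"] by (metis leading_coeff_0_iff)
  then show ?thesis by auto
qed

text \<open>Nonvanishing on the whole forward orbit, not only at \<open>a\<close>, makes this set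
  stable under x -> x^k, as the iteration of a system demands.\<close>

definition orbit_units :: "nat \<Rightarrow> 'e::field \<Rightarrow> 'e poly set" where
  "orbit_units k a = {Q. \<forall>s. poly Q (a ^ (k ^ s)) \<noteq> 0}"

lemma mult_set_orbit_units: "mult_set (orbit_units k a)"
  by (auto simp: mult_set_def orbit_units_def)

lemma psub_orbit_units: "Q \<in> orbit_units k a \<Longrightarrow> psub 1 k Q \<in> orbit_units k a"
proof -
  assume Q: "Q \<in> orbit_units k a"
  have "poly Q ((a ^ (k ^ s)) ^ k) \<noteq> 0" for s
  proof -
    have "(a ^ (k ^ s)) ^ k = a ^ (k ^ Suc s)" by (simp add: mult.commute flip: power_mult)
    moreover have "poly Q (a ^ (k ^ Suc s)) \<noteq> 0" using Q unfolding orbit_units_def by blast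
    ultimately show ?thesis by metis
  qed
  then show ?thesis by (auto simp: orbit_units_def)
qed

lemma orbit_units_root: "Q \<in> orbit_units k a \<Longrightarrow> poly Q a \<noteq> 0"
  unfolding orbit_units_def by (auto dest: spec[of _ 0])

lemma poly_power_eventually_nonzero:
  fixes a :: "'e::field"
  assumes "p \<noteq> 0" and a: "a \<noteq> 0" "\<And>N. N > 0 \<Longrightarrow> a ^ N \<noteq> 1"
  shows "\<exists>B. \<forall>i>B. poly p (a ^ i) \<noteq> 0"
proof -
  have ne: "a ^ m \<noteq> a ^ n" if "m < n" for m n
  proof
    assume "a ^ m = a ^ n"
    also have "a ^ n = a ^ m * a ^ (n - m)" using that by (simp flip: power_add)
    finally have "a ^ (n - m) = 1" using a by simp
    then show False using a(2)[of "n - m"] that by simp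
  qed
  have "inj (\<lambda>i. a ^ i)"
    by (rule injI) (metis ne linorder_neqE_nat)
  then have "finite ((\<lambda>i. a ^ i) -` {x. poly p x = 0})"
    using poly_roots_finite[OF assms(1)] by (intro finite_vimageI)
  then obtain B where "\<forall>i \<in> (\<lambda>i. a ^ i) -` {x. poly p x = 0}. i \<le> B"
    using finite_nat_set_iff_bounded_le by blast
  then show ?thesis by (metis vimageI mem_Collect_eq not_le)
qed

section \<open>Roots of unity and the polynomials x^N - 1\<close>

definition cyclo :: "nat \<Rightarrow> 'e::field poly" where "cyclo N = monom 1 N - 1"

lemma poly_cyclo: "poly (cyclo N) b = b ^ N - 1"
  by (simp add: cyclo_def poly_monom)

lemma cyclo_nonzero:
  assumes "N > 0" shows "cyclo N \<noteq> (0 :: 'e::field poly)"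
proof
  assume "cyclo N = (0 :: 'e poly)"
  then have "poly (cyclo N) (0::'e) = 0" by simp
  then show False using assms by (simp add: poly_cyclo power_0_left)
qed

lemma psub_cyclo: "psub 1 K (cyclo N) = cyclo (N * K)"
  by (simp add: cyclo_def psub_diff psub_monom)

lemma cyclo_mult:
  "\<exists>w::'e::field poly. cyclo (N * K) = cyclo N * w \<and> (\<forall>b. b ^ N = 1 \<longrightarrow> poly w b = of_nat K)"
proof -
  let ?w = "\<Sum>i<K. (monom 1 N :: 'e poly) ^ i"
  have "cyclo (N * K) = monom 1 N ^ K - (1 :: 'e poly)" by (simp add: cyclo_def monom_power)
  also have "\<dots> = cyclo N * ?w" unfolding cyclo_def by (rule power_diff_1_eq)
  finally have "cyclo (N * K) = cyclo N * ?w" .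
  moreover have "poly ?w b = of_nat K" if "b ^ N = 1" for b
    using that by (simp add: poly_sum poly_power poly_monom)
  ultimately show ?thesis by blast
qed

text \<open>Only divisibility is claimed, so each linear factor x - b with b^N = 1 may be traded for
  the whole of x^N - 1.\<close>

lemma factor_roots_of_unity:
  fixes P :: "'e::field poly"
  assumes "P \<noteq> 0"
  shows "\<exists>e Q. P dvd cyclo N ^ e * Q \<and> (\<forall>b. b ^ N = 1 \<longrightarrow> poly Q b \<noteq> 0)"
  using assms
proof (induction "degree P" arbitrary: P rule: less_induct)
  case less
  show ?case
  proof (cases "\<exists>b. b ^ N = 1 \<and> poly P b = 0")
    case False
    then show ?thesis by (intro exI[of _ 0] exI[of _ P]) auto
  next
    case True
    then obtain b where b: "b ^ N = 1" "poly P b = 0" by blast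
    then obtain P' where P': "P = [:-b, 1:] * P'" unfolding poly_eq_0_iff_dvd by (elim conjE dvdE)
    then have "P' \<noteq> 0" using less.prems by auto
    moreover from this have "degree P' < degree P"
      unfolding P' by (subst degree_mult_eq) auto
    ultimately obtain e Q where Q: "P' dvd cyclo N ^ e * Q" "\<forall>b. b ^ N = 1 \<longrightarrow> poly Q b \<noteq> 0"
      using less.hyps by blast
    have "[:-b, 1:] dvd cyclo N"
      using b(1) by (simp add: poly_eq_0_iff_dvd[symmetric] poly_cyclo)
    from mult_dvd_mono[OF this Q(1)] show ?thesis
      using Q(2) unfolding P' by (intro exI[of _ "Suc e"] exI[of _ Q]) (simp add: mult.assoc)
  qed
qed

text \<open>By finiteness a^(k^s) = a^(k^(s+t)) for some s and t. The ratio of a^(k^t) and a is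
  killed by k^s and by N, which are coprime, so the orbit is periodic from the start and not just
  eventually.\<close>

lemma power_periodic:
  fixes a :: "'e::field"
  assumes "N > 0" "coprime N k" "a ^ N = 1"
  shows "\<exists>t\<ge>1. a ^ (k ^ t) = a"
proof -
  have a0: "a \<noteq> 0" using assms by (auto simp: power_0_left)
  have "(a ^ m) ^ N = 1" for m using assms by (metis mult.commute power_mult power_one)
  then have "range (\<lambda>s. a ^ (k ^ s)) \<subseteq> {x. x ^ N = 1}" by auto
  then have "finite (range (\<lambda>s::nat. a ^ (k ^ s)))"
    using finite_nth_roots_1[OF assms(1)] finite_subset by blast
  then have "\<not> inj (\<lambda>s::nat. a ^ (k ^ s))" using finite_imageD infinite_UNIV_nat by blast
  then obtain s s' where "s \<noteq> s'" "a ^ (k ^ s) = a ^ (k ^ s')" by (auto simp: inj_def)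
  then obtain s t where st: "t \<ge> 1" "a ^ (k ^ s) = a ^ (k ^ (s + t))"
    by (metis less_eq_Suc_le less_imp_add_positive linorder_neqE_nat One_nat_def)
  have "(a ^ (k ^ t) / a) ^ (k ^ s) = 1"
    using st(2) a0 by (simp add: power_divide power_add mult.commute flip: power_mult)
  moreover have "(a ^ (k ^ t) / a) ^ N = 1"
    using \<open>\<And>m. (a ^ m) ^ N = 1\<close> assms(3) by (simp add: power_divide)
  ultimately have "a ^ (k ^ t) / a = 1"
    using power_coprime_eq_1[of "a ^ (k ^ t) / a" N "k ^ s"] assms by auto
  then show ?thesis using st a0 by (auto simp: divide_eq_1_iff)
qed

section \<open>Relations modulo the twists\<close>

locale mahler_q_multiplicative = q_multiplicative +
  fixes d :: "'a poly" and n0 :: nat and P0 :: "nat \<Rightarrow> 'a poly"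
  assumes d_nz: "d \<noteq> 0" and n0: "n0 \<ge> 1"
    and rel: "fps_of_poly d * F = (\<Sum>j=1..n0. fps_of_poly (P0 j) * fsub 1 (k ^ j) F)"
begin

text \<open>Up to a nonzero factor the twists come from x -> x^k, so a section can be taken of a
  relation modulo twists.\<close>

lemma twists_saturated_nonzero: "NN \<subseteq> sat nonzero_polys (fsub 1 k ` twists q k F)"
proof
  fix Z assume Z: "Z \<in> NN"
  show "Z \<in> sat nonzero_polys (fsub 1 k ` twists q k F)"
  proof (rule sat_span[OF mult_set_nonzero _ Z], rule subsetI)
    fix x assume "x \<in> twists q k F"
    then obtain \<eta> j m where x: "x = fsub \<eta> (k ^ j) F" "\<eta> \<in> tors q m" by (auto simp: twists_def)
    have "\<eta> \<noteq> 0" using x(2) q_pos by (auto simp: tors_def power_0_left split: if_splits)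
    show "x \<in> sat nonzero_polys (fsub 1 k ` twists q k F)"
    proof (cases j)
      case 0
      have "psub \<eta> 1 d \<in> nonzero_polys"
        using \<open>\<eta> \<noteq> 0\<close> d_nz by (simp add: nonzero_polys_def psub_eq_0_iff)
      moreover have "fsub \<theta> (k ^ i) F \<in> twists q k F" if "\<theta> \<in> tors q m" for \<theta> i
        using that unfolding twists_def by blast
      ultimately have "fsub \<eta> 1 F \<in> sat nonzero_polys (fsub 1 k ` twists q k F)"
        by (intro twist_saturated[OF rel mult_set_nonzero x(2)])
      then show ?thesis using x 0 by simp
    next
      case (Suc i)
      have "fsub \<eta> (k ^ i) F \<in> twists q k F" using x unfolding twists_def by blast
      moreover have "x = fsub 1 k (fsub \<eta> (k ^ i) F)" using x Suc k_pos by (simp add: fsub_fsub)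
      ultimately show ?thesis
        by (intro span_sat[OF mult_set_nonzero] fpsm.span_base) auto
    qed
  qed
qed

lemma relation_0: "(\<Sum>j\<le>n0. fps_of_poly (if j = 0 then d else - P0 j) * fsub 1 (k ^ j) F) = 0"
proof -
  have "(\<Sum>j\<le>n0. fps_of_poly (if j = 0 then d else - P0 j) * fsub 1 (k ^ j) F) =
      fps_of_poly d * F + (\<Sum>j=1..n0. fps_of_poly (- P0 j) * fsub 1 (k ^ j) F)"
    unfolding atMost_atLeast0 by (subst sum.atLeast_Suc_atMost) (auto intro!: sum.cong)
  then show ?thesis unfolding rel by (simp add: fps_of_poly_uminus sum_negf)
qed

lemma minimal_relation:
  "\<exists>P c J. P \<noteq> 0 \<and> c 0 \<noteq> 0 \<and>
    fps_of_poly P * (\<Sum>j\<le>J. fps_of_poly [:c j:] * fsub 1 (k ^ j) F) \<in> NN"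
proof -
  define R where "R J \<longleftrightarrow> (\<exists>P. (\<exists>j\<le>J. P j \<noteq> 0) \<and>
      (\<Sum>j\<le>J. fps_of_poly (P j) * fsub 1 (k ^ j) F) \<in> NN)" for J
  have "R n0"
    unfolding R_def using relation_0 d_nz
    by (intro exI[of _ "\<lambda>j. if j = 0 then d else - P0 j"]) (auto simp: fpsm.span_zero)
  define J where "J = (LEAST J. R J)"
  have RJ: "R J" unfolding J_def using \<open>R n0\<close> by (rule LeastI)
  have minJ: "\<not> R i" if "i < J" for i using that unfolding J_def by (rule not_less_Least)
  obtain P where P: "\<exists>j\<le>J. P j \<noteq> 0" "(\<Sum>j\<le>J. fps_of_poly (P j) * fsub 1 (k ^ j) F) \<in> NN"
    using RJ by (auto simp: R_def)
  have vanish: "\<forall>j\<le>J. Q j = 0"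
    if "(\<Sum>j\<le>J. fps_of_poly (Q j) * fsub 1 (k ^ j) F) \<in> NN" "Q J = 0" for Q
  proof (cases J)
    case 0
    then show ?thesis using that by auto
  next
    case (Suc i)
    then have "(\<Sum>j\<le>i. fps_of_poly (Q j) * fsub 1 (k ^ j) F) \<in> NN" using that by simp
    then have "\<forall>j\<le>i. Q j = 0" using minJ[of i] Suc unfolding R_def by auto
    then show ?thesis using Suc that(2) by (auto simp: le_Suc_eq)
  qed
  have PJ: "P J \<noteq> 0" using vanish[OF P(2)] P(1) by auto
  \<comment> \<open>The top coefficients cancel, so by minimality all coefficients vanish: each
    ratio P j / P J is invariant under x -> x^q.\<close>
  have "(\<Sum>j\<le>J. fps_of_poly (psub 1 q (P J) * P j - P J * psub 1 q (P j)) * fsub 1 (k ^ j) F) \<in> NN"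
    using fpsm.span_diff[OF fpsm.span_scale[OF P(2), of "psub 1 q (P J)"]
        fpsm.span_scale[OF relation_fsub_q[OF P(2)], of "P J"]]
    by (simp add: sum_distrib_left fps_of_poly_mult fps_of_poly_diff sum_subtractf algebra_simps)
  from vanish[OF this] have "\<forall>j\<le>J. psub 1 q (P J) * P j = P J * psub 1 q (P j)" by (simp add: mult.commute)
  then have "\<forall>j\<le>J. \<exists>c. P j = smult c (P J)" using psub_ratio_const[OF q PJ] by blast
  then obtain c where c: "\<And>j. j \<le> J \<Longrightarrow> P j = smult (c j) (P J)" by metis
  have cJ: "c J \<noteq> 0" using c[of J] PJ by auto
  have smult_const: "fps_of_poly (smult b Q) = fps_of_poly Q * fps_of_poly [:b:]" for b and Q :: "'a poly"
    by (simp flip: fps_of_poly_mult)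
  have "(\<Sum>j\<le>J. fps_of_poly (P j) * fsub 1 (k ^ j) F) =
      fps_of_poly (P J) * (\<Sum>j\<le>J. fps_of_poly [:c j:] * fsub 1 (k ^ j) F)"
    unfolding sum_distrib_left
  proof (rule sum.cong[OF refl])
    fix j assume "j \<in> {..J}"
    then have "fps_of_poly (P j) = fps_of_poly (P J) * fps_of_poly [:c j:]"
      using c[of j] smult_const by simp
    then show "fps_of_poly (P j) * fsub 1 (k ^ j) F =
        fps_of_poly (P J) * (fps_of_poly [:c j:] * fsub 1 (k ^ j) F)" by (simp only: mult.assoc)
  qed
  then have main: "fps_of_poly (P J) * (\<Sum>j\<le>J. fps_of_poly [:c j:] * fsub 1 (k ^ j) F) \<in> NN"
    using P(2) by simp
  have "c 0 \<noteq> 0"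
  proof
    \<comment> \<open>Without the term for j = 0 the bracket is the substitution x -> x^k of a
      shorter \<open>H\<close>; a section gives a relation for \<open>H\<close> and contradicts
      minimality.\<close>
    assume c0: "c 0 = 0"
    then obtain i where J: "J = Suc i" using cJ by (cases J) auto
    define H where "H = (\<Sum>j\<le>i. fps_of_poly [:c (Suc j):] * fsub 1 (k ^ j) F)"
    have "(\<Sum>j\<le>J. fps_of_poly [:c j:] * fsub 1 (k ^ j) F) = fsub 1 k H"
      unfolding J sum.atMost_Suc_shift H_def
      using c0 k_pos by (simp add: fsub_sum fsub_mult fsub_of_poly fsub_fsub psub_def)
    then have "fps_of_poly (P J) * fsub 1 k H \<in> sat nonzero_polys (fsub 1 k ` twists q k F)"
      using main twists_saturated_nonzero by auto
    then obtain Q where Q: "Q \<noteq> 0"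
      "fps_of_poly Q * (fps_of_poly (P J) * fsub 1 k H) \<in> fpsm.span (fsub 1 k ` twists q k F)"
      by (auto simp: sat_def nonzero_polys_def)
    then have "fps_of_poly (Q * P J) * fsub 1 k H \<in> fpsm.span (fsub 1 k ` twists q k F)"
      by (simp add: fps_of_poly_mult mult.assoc)
    from span_fsub_independent[OF k_pos _ this] obtain p where p: "p \<noteq> 0" "fps_of_poly p * H \<in> NN"
      using Q PJ by auto
    have "fps_of_poly p * H = (\<Sum>j\<le>i. fps_of_poly (smult (c (Suc j)) p) * fsub 1 (k ^ j) F)"
      unfolding H_def sum_distrib_left smult_const by (simp only: mult.assoc)
    then have "R i" unfolding R_def
      using p cJ J by (intro exI[of _ "\<lambda>j. smult (c (Suc j)) p"]) auto
    then show False using minJ[of i] J by simp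
  qed
  then show ?thesis using main PJ by blast
qed

end

section \<open>Mahler equations with leading coefficient nonzero at a given point\<close>

context mahler_q_multiplicative
begin

lemma regular_elimination_at:
  assumes a: "\<And>\<eta> m s. \<eta> \<in> tors q m \<Longrightarrow> poly d (\<eta> * a ^ (k ^ s)) \<noteq> 0"
    and H: "H \<in> sat (orbit_units k a) ({fsub 1 (k ^ j) H |j. j \<ge> 1} \<union> twists q k F)"
    and d': "d' \<noteq> 0" "n \<ge> 1" "fps_of_poly d' * H \<in> fpsm.span ((\<lambda>j. fsub 1 (k ^ j) H) ` {1..n})"
  shows "\<exists>D. D \<noteq> 0 \<and> (\<forall>r. \<exists>Q\<in>orbit_units k a. fps_of_poly (Q * psub 1 (k ^ r) D) * H
      \<in> fpsm.span ((\<lambda>j. fsub 1 (k ^ (r + j)) H) ` {..<n}))"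
proof -
  have "psub \<eta> 1 d \<in> orbit_units k a" if "\<eta> \<in> tors q m" for \<eta> m
    using a[OF that] by (simp add: orbit_units_def)
  then have "\<exists>G. finite G \<and> H \<in> G \<and> G \<subseteq> sat (orbit_units k a) (fsub 1 k ` G)"
    by (rule exists_regular_system[OF rel mult_set_orbit_units _ H])
  then obtain G where G: "finite G" "H \<in> G" "G \<subseteq> sat (orbit_units k a) (fsub 1 k ` G)" by blast
  show ?thesis
    by (rule regular_system_elimination[OF k_pos d' mult_set_orbit_units psub_orbit_units G(1,3,2)])
qed

abbreviation "VV \<equiv> fpsm.span {fsub 1 (k ^ j) F |j. j \<ge> 1}"

lemma not_root_of_unity_case:
  assumes a: "\<And>\<eta> m s. \<eta> \<in> tors q m \<Longrightarrow> poly d (\<eta> * a ^ (k ^ s)) \<noteq> 0"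
    and a0: "a \<noteq> 0" "\<And>N. N > 0 \<Longrightarrow> a ^ N \<noteq> 1"
  shows "\<exists>P. poly P a \<noteq> 0 \<and> fps_of_poly P * F \<in> VV"
proof -
  obtain B where B: "\<And>i. i > B \<Longrightarrow> poly d (a ^ i) \<noteq> 0"
    using poly_power_eventually_nonzero[OF d_nz a0] by blast
  \<comment> \<open>As 2^(B+1) > B, the exponents q^m k^s exceed B for all s simultaneously.\<close>
  let ?m = "Suc B"
  have "q ^ ?m * k ^ s > B" for s
  proof -
    have "B < 2 ^ ?m" using less_exp[of ?m] by simp
    also have "\<dots> \<le> q ^ ?m" using q by (rule power_mono) simp
    also have "\<dots> \<le> q ^ ?m * k ^ s" using k_pos by simp
    finally show ?thesis .
  qed
  then have m: "psub 1 (q ^ ?m) d \<in> orbit_units k a"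
    using B by (simp add: orbit_units_def mult.commute flip: power_mult)
  let ?P = "\<lambda>j. if j = 0 then d else - P0 j"
  have "(\<Sum>j\<le>n0. fps_of_poly (psub 1 (q ^ ?m) (?P j)) * fsub 1 (k ^ j) F) \<in> NN"
    using relation_0 by (intro relation_fsub_q_pow) (simp add: fpsm.span_zero)
  also have "(\<Sum>j\<le>n0. fps_of_poly (psub 1 (q ^ ?m) (?P j)) * fsub 1 (k ^ j) F) =
      fps_of_poly (psub 1 (q ^ ?m) d) * F +
      (\<Sum>j=1..n0. fps_of_poly (psub 1 (q ^ ?m) (- P0 j)) * fsub 1 (k ^ j) F)"
    unfolding atMost_atLeast0 by (subst sum.atLeast_Suc_atMost) (auto intro!: sum.cong)
  finally have *: "fps_of_poly (psub 1 (q ^ ?m) d) * F +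
      (\<Sum>j=1..n0. fps_of_poly (psub 1 (q ^ ?m) (- P0 j)) * fsub 1 (k ^ j) F) \<in> NN" .
  let ?U = "{fsub 1 (k ^ j) F |j. j \<ge> 1} \<union> twists q k F"
  have "NN \<subseteq> fpsm.span ?U" by (intro fpsm.span_mono) auto
  moreover have tail:
    "(\<Sum>j=1..n0. fps_of_poly (psub 1 (q ^ ?m) (- P0 j)) * fsub 1 (k ^ j) F) \<in> fpsm.span ?U"
    by (intro fpsm.span_sum fpsm.span_scale fpsm.span_base) auto
  ultimately have "fps_of_poly (psub 1 (q ^ ?m) d) * F \<in> fpsm.span ?U"
    using fpsm.span_diff[OF subsetD[OF _ *] tail] by (simp only: add_diff_cancel_right')
  then have "F \<in> sat (orbit_units k a) ?U" using m by (auto simp: sat_def)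
  moreover have "fps_of_poly d * F \<in> fpsm.span ((\<lambda>j. fsub 1 (k ^ j) F) ` {1..n0})"
    unfolding rel by (intro fpsm.span_sum fpsm.span_scale fpsm.span_base) auto
  ultimately obtain D where D: "D \<noteq> 0" "\<And>r. \<exists>Q\<in>orbit_units k a. fps_of_poly (Q * psub 1 (k ^ r) D) * F
      \<in> fpsm.span ((\<lambda>j. fsub 1 (k ^ (r + j)) F) ` {..<n0})"
    using regular_elimination_at[of a F d n0] a d_nz n0 by blast
  obtain B' where B': "\<And>i. i > B' \<Longrightarrow> poly D (a ^ i) \<noteq> 0"
    using poly_power_eventually_nonzero[OF D(1) a0] by blast
  \<comment> \<open>Besides k^r > B', the successor ensures r >= 1, so every iterate on the right
    lies in \<open>VV\<close>.\<close>
  let ?r = "Suc B'"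
  obtain Q where Q: "Q \<in> orbit_units k a" "fps_of_poly (Q * psub 1 (k ^ ?r) D) * F
      \<in> fpsm.span ((\<lambda>j. fsub 1 (k ^ (?r + j)) F) ` {..<n0})" using D(2) by blast
  have "B' < 2 ^ ?r" using less_exp[of ?r] by simp
  also have "\<dots> \<le> k ^ ?r" using k by (rule power_mono) simp
  finally have "poly D (a ^ (k ^ ?r)) \<noteq> 0" by (rule B')
  then have "poly (Q * psub 1 (k ^ ?r) D) a \<noteq> 0"
    using orbit_units_root[OF Q(1)] by simp
  moreover have "fpsm.span ((\<lambda>j. fsub 1 (k ^ (?r + j)) F) ` {..<n0}) \<subseteq> VV"
    by (intro fpsm.span_mono) (auto intro!: exI[of _ "Suc (B' + _)"])
  ultimately show ?thesis using Q(2) by blast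
qed

text \<open>
  At a root of unity \<open>a\<close> of order prime to \<open>k\<close> the relation has to be cleared of the factors
  vanishing on the orbit of \<open>a\<close>: these divide a power of \<open>x\<^sup>N - 1\<close>, which is absorbed into \<open>H\<close>.
  It is harmless there, since \<open>x\<^sup>N - 1\<close> divides its substitutions with a cofactor not vanishing
  at \<open>N\<close>-th roots of unity.
\<close>

lemma root_of_unity_elimination:
  assumes a: "\<And>\<eta> m s. \<eta> \<in> tors q m \<Longrightarrow> poly d (\<eta> * a ^ (k ^ s)) \<noteq> 0"
    and N: "N > 0" "a ^ N = 1"
  shows "\<exists>D Q C. D \<noteq> 0 \<and> (\<forall>r. Q r \<in> orbit_units k a \<and> fps_of_poly (Q r * psub 1 (k ^ r) D) * F
      = (\<Sum>j<n0. fps_of_poly (C r j) * fsub 1 (k ^ (r + j)) F))"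
proof -
  have orbit: "(a ^ (k ^ s)) ^ N = 1" for s using N(2) by (metis mult.commute power_mult power_one)
  obtain P c J where P: "P \<noteq> 0" "c 0 \<noteq> 0"
    "fps_of_poly P * (\<Sum>j\<le>J. fps_of_poly [:c j:] * fsub 1 (k ^ j) F) \<in> NN"
    using minimal_relation by blast
  obtain e Q where Q: "P dvd cyclo N ^ e * Q" "\<And>b. b ^ N = 1 \<Longrightarrow> poly Q b \<noteq> 0"
    using factor_roots_of_unity[OF P(1), of N] by blast
  define E :: "'a poly" where "E = cyclo N ^ e"
  define H where "H = fps_of_poly E * F"
  have E0: "E \<noteq> 0" using N(1) by (simp add: E_def cyclo_nonzero)
  have "\<exists>w. psub 1 (k ^ j) E = E * w \<and> (\<forall>b. b ^ N = 1 \<longrightarrow> poly w b \<noteq> 0)" for j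
  proof -
    obtain w :: "'a poly" where "psub 1 (k ^ j) (cyclo N) = cyclo N * w" "\<forall>b. b ^ N = 1 \<longrightarrow> poly w b = of_nat (k ^ j)"
      using cyclo_mult unfolding psub_cyclo by blast
    then show ?thesis using k_pos unfolding E_def psub_power
      by (intro exI[of _ "w ^ e"]) (simp add: power_mult_distrib)
  qed
  then obtain w where w: "\<And>j. psub 1 (k ^ j) E = E * w j" "\<And>j b. b ^ N = 1 \<Longrightarrow> poly (w j) b \<noteq> 0"
    by metis
  have MH: "fsub 1 (k ^ j) H = fps_of_poly (w j) * (fps_of_poly E * fsub 1 (k ^ j) F)" for j
    using k_pos by (simp add: H_def fsub_mult fsub_of_poly w(1) fps_of_poly_mult mult_ac)
  let ?\<D> = "orbit_units k a"
  let ?U = "{fsub 1 (k ^ j) H |j. j \<ge> 1} \<union> twists q k F"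
  have units: "R \<in> ?\<D>" if "\<And>b. b ^ N = 1 \<Longrightarrow> poly R b \<noteq> 0" for R
    using that orbit by (auto simp: orbit_units_def)
  have sat_j: "fps_of_poly E * fsub 1 (k ^ j) F \<in> sat ?\<D> ?U" if "j \<ge> 1" for j
  proof (rule sat_cancel[OF mult_set_orbit_units units[OF w(2)]])
    show "fps_of_poly (w j) * (fps_of_poly E * fsub 1 (k ^ j) F) \<in> sat ?\<D> ?U"
      using that unfolding MH[symmetric]
      by (intro span_sat[OF mult_set_orbit_units] fpsm.span_base) auto
  qed
  have H: "H \<in> sat ?\<D> ?U"
  proof (rule sat_cancel[OF mult_set_orbit_units, of "[:c 0:] * Q"])
    show "[:c 0:] * Q \<in> ?\<D>" using P(2) Q(2) by (intro units) simp
    \<comment> \<open>Multiplication by \<open>A\<close> replaces \<open>P\<close> by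
      \<open>E * Q\<close>; \<open>E\<close> goes into \<open>H\<close>, and \<open>Q\<close> has no
      zero among the N-th roots of unity.\<close>
    obtain A where A: "E * Q = P * A" using Q(1) unfolding E_def by (elim dvdE)
    let ?S = "\<Sum>j=1..J. fps_of_poly ([:c j:] * Q) * (fps_of_poly E * fsub 1 (k ^ j) F)"
    have "fps_of_poly A * (fps_of_poly P * (\<Sum>j\<le>J. fps_of_poly [:c j:] * fsub 1 (k ^ j) F)) \<in> NN"
      using P(3) by (rule fpsm.span_scale)
    also have "fps_of_poly A * (fps_of_poly P * (\<Sum>j\<le>J. fps_of_poly [:c j:] * fsub 1 (k ^ j) F)) =
        fps_of_poly (E * Q) * (\<Sum>j\<le>J. fps_of_poly [:c j:] * fsub 1 (k ^ j) F)"
      unfolding A fps_of_poly_mult by (simp only: mult_ac)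
    also have "\<dots> = (\<Sum>j=0..J. fps_of_poly ([:c j:] * Q) * (fps_of_poly E * fsub 1 (k ^ j) F))"
      unfolding sum_distrib_left atMost_atLeast0 fps_of_poly_mult by (simp only: mult_ac)
    also have "\<dots> = fps_of_poly ([:c 0:] * Q) * H + ?S"
      by (subst sum.atLeast_Suc_atMost) (simp_all add: H_def)
    finally have "fps_of_poly ([:c 0:] * Q) * H + ?S \<in> NN" .
    moreover have "NN \<subseteq> fpsm.span ?U" by (intro fpsm.span_mono) auto
    ultimately have "fps_of_poly ([:c 0:] * Q) * H + ?S \<in> sat ?\<D> ?U"
      using span_sat[OF mult_set_orbit_units] by blast
    moreover have "?S \<in> sat ?\<D> ?U"
      by (intro fpsm.subspace_sum[OF sat_subspace[OF mult_set_orbit_units]]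
          fpsm.subspace_scale[OF sat_subspace[OF mult_set_orbit_units]] sat_j) auto
    ultimately have "fps_of_poly ([:c 0:] * Q) * H + ?S - ?S \<in> sat ?\<D> ?U"
      by (rule fpsm.subspace_diff[OF sat_subspace[OF mult_set_orbit_units]])
    then show "fps_of_poly ([:c 0:] * Q) * H \<in> sat ?\<D> ?U"
      by (simp only: add_diff_cancel_right')
  qed
  \<comment> \<open>The j-th iterate of \<open>H\<close> is \<open>w j\<close> times
    \<open>E\<close> times that of \<open>F\<close>; with all \<open>w j\<close> as a factor, the
    equation of \<open>F\<close> multiplied by \<open>E\<close> becomes one for
    \<open>H\<close>.\<close>
  define d' where "d' = (\<Prod>j=1..n0. w j) * d"
  have d': "d' \<noteq> 0" "fps_of_poly d' * H \<in> fpsm.span ((\<lambda>j. fsub 1 (k ^ j) H) ` {1..n0})"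
  proof -
    have "poly (w j) a \<noteq> 0" for j using w(2) N by blast
    then have "w j \<noteq> 0" for j by (metis poly_0)
    then show "d' \<noteq> 0" using d_nz by (simp add: d'_def)
    have "fps_of_poly d' * H =
        (\<Sum>j=1..n0. fps_of_poly ((\<Prod>j=1..n0. w j) * P0 j) * (fps_of_poly E * fsub 1 (k ^ j) F))"
    proof -
      have "fps_of_poly d' * H = fps_of_poly (\<Prod>j=1..n0. w j) * (fps_of_poly E * (fps_of_poly d * F))"
        by (simp only: d'_def H_def fps_of_poly_mult mult_ac)
      also have "\<dots> = (\<Sum>j=1..n0. fps_of_poly ((\<Prod>j=1..n0. w j) * P0 j) * (fps_of_poly E * fsub 1 (k ^ j) F))"
        unfolding rel sum_distrib_left fps_of_poly_mult by (simp only: mult_ac)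
      finally show ?thesis .
    qed
    also have "\<dots> \<in> fpsm.span ((\<lambda>j. fsub 1 (k ^ j) H) ` {1..n0})"
    proof (rule fpsm.span_sum)
      fix j assume j: "j \<in> {1..n0}"
      then have "(\<Prod>j=1..n0. w j) = w j * (\<Prod>i\<in>{1..n0} - {j}. w i)" by (simp add: prod.remove)
      then have "fps_of_poly ((\<Prod>j=1..n0. w j) * P0 j) * (fps_of_poly E * fsub 1 (k ^ j) F) =
          fps_of_poly ((\<Prod>i\<in>{1..n0} - {j}. w i) * P0 j) * fsub 1 (k ^ j) H"
        unfolding MH by (simp only: fps_of_poly_mult mult_ac)
      then show "fps_of_poly ((\<Prod>j=1..n0. w j) * P0 j) * (fps_of_poly E * fsub 1 (k ^ j) F)
          \<in> fpsm.span ((\<lambda>j. fsub 1 (k ^ j) H) ` {1..n0})"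
        using fpsm.span_scale[OF fpsm.span_base[OF imageI[OF j]]] by metis
    qed
    finally show "fps_of_poly d' * H \<in> fpsm.span ((\<lambda>j. fsub 1 (k ^ j) H) ` {1..n0})" .
  qed
  obtain D where D: "D \<noteq> 0" "\<And>r. \<exists>Q\<in>?\<D>. fps_of_poly (Q * psub 1 (k ^ r) D) * H
      \<in> fpsm.span ((\<lambda>j. fsub 1 (k ^ (r + j)) H) ` {..<n0})"
    using regular_elimination_at[of a H d' n0] a H d' n0 by blast
  define rel_at where "rel_at r Q C \<longleftrightarrow> Q \<in> ?\<D> \<and> fps_of_poly (Q * psub 1 (k ^ r) D) * F
      = (\<Sum>j<n0. fps_of_poly (C j) * fsub 1 (k ^ (r + j)) F)" for r Q C
  have "\<exists>Q C. rel_at r Q C" for r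
  proof -
    obtain R where R: "R \<in> ?\<D>" "fps_of_poly (R * psub 1 (k ^ r) D) * H
      \<in> fpsm.span ((\<lambda>j. fsub 1 (k ^ (r + j)) H) ` {..<n0})" using D(2) by blast
    from span_image_sum[OF _ R(2)] obtain C where
      C: "fps_of_poly (R * psub 1 (k ^ r) D) * H = (\<Sum>j<n0. fps_of_poly (C j) * fsub 1 (k ^ (r + j)) H)"
      by auto
    have "fps_of_poly E * (fps_of_poly (R * psub 1 (k ^ r) D) * F) =
        fps_of_poly (R * psub 1 (k ^ r) D) * H"
      by (simp only: H_def mult_ac)
    also have "\<dots> = fps_of_poly E * (\<Sum>j<n0. fps_of_poly (C j * w (r + j)) * fsub 1 (k ^ (r + j)) F)"
      unfolding C unfolding MH sum_distrib_left fps_of_poly_mult by (simp only: mult_ac)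
    finally have "fps_of_poly (R * psub 1 (k ^ r) D) * F =
        (\<Sum>j<n0. fps_of_poly (C j * w (r + j)) * fsub 1 (k ^ (r + j)) F)"
      using E0 by simp
    then show ?thesis using R(1) by (intro exI[of _ R] exI[of _ "\<lambda>j. C j * w (r + j)"]) (simp add: rel_at_def)
  qed
  then obtain Q C where "\<And>r. rel_at r (Q r) (C r)" by metis
  then show ?thesis using D(1) unfolding rel_at_def by blast
qed

text \<open>\<open>D\<close> may vanish on the whole orbit. With period t, substituting x^(k^(t (J -
  i))) in the relation for r = t i gives all of them the factor D(x^(k^(t J))) and the same iterates
  of \<open>F\<close> on the right. The dependence between the rows then equates
  \<open>\<gamma>\<close> times the J-th relation with a combination of earlier ones, and the common
  factor cancels.\<close>

lemma root_of_unity_case: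
  assumes a: "\<And>\<eta> m s. \<eta> \<in> tors q m \<Longrightarrow> poly d (\<eta> * a ^ (k ^ s)) \<noteq> 0"
    and N: "N > 0" "a ^ N = 1" "coprime N k"
  shows "\<exists>P. poly P a \<noteq> 0 \<and> fps_of_poly P * F \<in> VV"
proof -
  obtain D Q C where D: "D \<noteq> 0" and Q: "\<And>r. Q r \<in> orbit_units k a" and
    C: "\<And>r. fps_of_poly (Q r * psub 1 (k ^ r) D) * F
      = (\<Sum>j<n0. fps_of_poly (C r j) * fsub 1 (k ^ (r + j)) F)"
    using root_of_unity_elimination[of a N] a N by blast
  obtain t where t: "t \<ge> 1" "a ^ (k ^ t) = a" using power_periodic[OF N(1,3,2)] by blast
  have a0: "a \<noteq> 0" using N by (auto simp: power_0_left)
  obtain J \<gamma> \<beta> where \<gamma>: "poly \<gamma> a \<noteq> 0" and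
    \<beta>: "\<And>j. j < n0 \<Longrightarrow> \<gamma> * C (t * J) j =
      (\<Sum>i<J. \<beta> i * psub 1 ((k ^ t) ^ (J - i)) (C (t * i) j))"
    using rows_stationary[OF a0 t(2), where n = n0 and c = "\<lambda>i. C (t * i)"] k_pos by auto
  let ?D = "psub 1 (k ^ (t * J)) D"
  have kt: "(k ^ t) ^ i = k ^ (t * i)" for i by (simp add: power_mult)
  have "fps_of_poly ?D * (fps_of_poly (\<gamma> * Q (t * J)) * F) =
      fps_of_poly \<gamma> * (fps_of_poly (Q (t * J) * ?D) * F)"
    by (simp only: fps_of_poly_mult mult_ac)
  also have "\<dots> = (\<Sum>j<n0. fps_of_poly (\<gamma> * C (t * J) j) * fsub 1 (k ^ (t * J + j)) F)"
    unfolding C unfolding sum_distrib_left fps_of_poly_mult by (simp only: mult_ac)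
  also have "\<dots> = (\<Sum>j<n0. \<Sum>i<J. fps_of_poly (\<beta> i) *
      (fps_of_poly (psub 1 (k ^ (t * (J - i))) (C (t * i) j)) * fsub 1 (k ^ (t * J + j)) F))"
    by (intro sum.cong refl)
       (simp add: \<beta> kt fps_of_poly_sum fps_of_poly_mult sum_distrib_right mult.assoc)
  also have "\<dots> = (\<Sum>i<J. fps_of_poly (\<beta> i) * (\<Sum>j<n0.
      fps_of_poly (psub 1 (k ^ (t * (J - i))) (C (t * i) j)) * fsub 1 (k ^ (t * J + j)) F))"
    unfolding sum_distrib_left by (rule sum.swap)
  also have "\<dots> = (\<Sum>i<J. fps_of_poly (\<beta> i) *
      fsub 1 (k ^ (t * (J - i))) (fps_of_poly (Q (t * i) * psub 1 (k ^ (t * i)) D) * F))"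
  proof (intro sum.cong refl arg_cong2[of _ _ _ _ "(*)"])
    fix i assume "i \<in> {..<J}"
    then have "t * (J - i) + t * i = t * J"
      by (simp add: diff_mult_distrib2)
    then show "(\<Sum>j<n0. fps_of_poly (psub 1 (k ^ (t * (J - i))) (C (t * i) j)) * fsub 1 (k ^ (t * J + j)) F) =
        fsub 1 (k ^ (t * (J - i))) (fps_of_poly (Q (t * i) * psub 1 (k ^ (t * i)) D) * F)"
      unfolding C using k_pos by (simp add: fsub_sum fsub_mult fsub_of_poly fsub_pow_pow flip: add.assoc)
  qed
  also have "\<dots> = (\<Sum>i<J. fps_of_poly ?D * (fps_of_poly (\<beta> i * psub 1 (k ^ (t * (J - i))) (Q (t * i))) *
      fsub 1 (k ^ (t * (J - i))) F))"
  proof (intro sum.cong refl)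
    fix i assume "i \<in> {..<J}"
    then have "k ^ (t * (J - i)) * k ^ (t * i) = k ^ (t * J)"
      by (simp add: diff_mult_distrib2 flip: power_add)
    then show "fps_of_poly (\<beta> i) *
        fsub 1 (k ^ (t * (J - i))) (fps_of_poly (Q (t * i) * psub 1 (k ^ (t * i)) D) * F) =
        fps_of_poly ?D * (fps_of_poly (\<beta> i * psub 1 (k ^ (t * (J - i))) (Q (t * i))) *
        fsub 1 (k ^ (t * (J - i))) F)"
      using k_pos by (simp add: fsub_mult fsub_of_poly psub_mult psub_psub fps_of_poly_mult mult_ac)
  qed
  finally have "fps_of_poly ?D * (fps_of_poly (\<gamma> * Q (t * J)) * F) =
      fps_of_poly ?D * (\<Sum>i<J. fps_of_poly (\<beta> i * psub 1 (k ^ (t * (J - i))) (Q (t * i))) *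
      fsub 1 (k ^ (t * (J - i))) F)"
    by (simp only: sum_distrib_left)
  moreover have "fps_of_poly ?D \<noteq> 0" using D k_pos by (simp add: psub_eq_0_iff)
  ultimately have "fps_of_poly (\<gamma> * Q (t * J)) * F =
      (\<Sum>i<J. fps_of_poly (\<beta> i * psub 1 (k ^ (t * (J - i))) (Q (t * i))) * fsub 1 (k ^ (t * (J - i))) F)"
    by simp
  also have "\<dots> \<in> VV"
  proof (intro fpsm.span_sum fpsm.span_scale fpsm.span_base)
    fix i assume "i \<in> {..<J}"
    then have "t * (J - i) \<ge> 1" using t(1) by (simp add: Suc_le_eq)
    then show "fsub 1 (k ^ (t * (J - i))) F \<in> {fsub 1 (k ^ j) F |j. j \<ge> 1}" by blast
  qed
  finally have "fps_of_poly (\<gamma> * Q (t * J)) * F \<in> VV" .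
  moreover have "poly (\<gamma> * Q (t * J)) a \<noteq> 0" using \<gamma> orbit_units_root[OF Q] by simp
  ultimately show ?thesis by blast
qed

end

section \<open>Passage to the algebraic closure\<close>

definition fac :: "'a::field fps \<Rightarrow> 'a alg_closure fps" where
  "fac F = Abs_fps (\<lambda>n. to_ac (F $ n))"

abbreviation acp :: "'a::field poly \<Rightarrow> 'a alg_closure poly" where
  "acp \<equiv> map_poly to_ac"

lemma fac_nth [simp]: "fac F $ n = to_ac (F $ n)"
  by (simp add: fac_def)

lemma fac_mult: "fac (F * G) = fac F * fac G"
  by (rule fps_ext) (simp add: fps_mult_nth to_ac_sum)

lemma fac_sum: "fac (sum f A) = (\<Sum>x\<in>A. fac (f x))"
  by (rule fps_ext) (simp add: fps_sum_nth to_ac_sum)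

lemma fac_of_poly: "fac (fps_of_poly p) = fps_of_poly (acp p)"
  by (rule fps_ext) (simp add: coeff_map_poly)

lemma fac_fsub: "K > 0 \<Longrightarrow> fac (fsub 1 K F) = fsub 1 K (fac F)"
  by (rule fps_ext) (simp add: fsub_nth)

lemma acp_mult: "acp (p * q) = acp p * acp q"
  by (rule poly_eqI) (simp add: coeff_map_poly coeff_mult to_ac_sum)

lemma acp_add: "acp (p + q) = acp p + acp q"
  by (rule poly_eqI) (simp add: coeff_map_poly)

lemma acp_diff: "acp (p - q) = acp p - acp q"
  by (rule poly_eqI) (simp add: coeff_map_poly)

lemma acp_power: "acp (p ^ n) = acp p ^ n"
  by (induction n) (simp_all add: acp_mult)

lemma acp_cyclo: "acp (cyclo N) = cyclo N"
  by (simp add: cyclo_def acp_diff map_poly_monom)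

lemma degree_acp [simp]: "degree (acp p) = degree p"
  by (rule degree_map_poly) simp

lemma acp_eq_0_iff [simp]: "acp p = 0 \<longleftrightarrow> p = 0"
  by (rule map_poly_eq_0_iff) auto

lemma acp_dvd_iff: "acp p dvd acp q \<longleftrightarrow> p dvd q"
proof
  assume dvd: "acp p dvd acp q"
  show "p dvd q"
  proof (cases "p = 0")
    case True
    then show ?thesis using dvd by simp
  next
    case False
    have "acp q = acp p * acp (q div p) + acp (q mod p)"
      by (simp flip: acp_mult acp_add)
    then have "acp p dvd acp (q mod p)" using dvd by (metis dvd_add_right_iff dvd_triv_left)
    then have "acp (q mod p) = 0"
      using degree_mod_less[OF False, of q] False by (metis acp_eq_0_iff degree_acp dvd_imp_degree_le not_less)
    then show ?thesis by (simp add: mod_eq_0_iff_dvd)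
  qed
next
  assume "p dvd q"
  then show "acp p dvd acp q" by (auto simp: acp_mult)
qed

lemma ac_vector_space: "vector_space (\<lambda>(c::'a::field) (x::'a alg_closure). to_ac c * x)"
  by unfold_locales (simp_all add: algebra_simps)

lemma exists_functional:
  fixes e :: "'a::field alg_closure"
  assumes "e \<noteq> 0"
  shows "\<exists>\<phi>::'a alg_closure \<Rightarrow> 'a. (\<forall>x y. \<phi> (x + y) = \<phi> x + \<phi> y) \<and>
    (\<forall>c x. \<phi> (to_ac c * x) = c * \<phi> x) \<and> \<phi> e \<noteq> 0"
proof -
  interpret V: vector_space "\<lambda>(c::'a) (x::'a alg_closure). to_ac c * x" by (rule ac_vector_space)
  interpret W: vector_space "\<lambda>(c::'a) (x::'a). c * x" by unfold_locales (simp_all add: algebra_simps)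
  interpret P: vector_space_pair "\<lambda>(c::'a) (x::'a alg_closure). to_ac c * x" "\<lambda>(c::'a) (x::'a). c * x" ..
  have "V.independent {e}" using assms V.dependent_single by simp
  from P.linear_independent_extend[OF this, of "\<lambda>_. 1"] obtain \<phi> where
    \<phi>: "Vector_Spaces.linear (\<lambda>(c::'a) (x::'a alg_closure). to_ac c * x) (\<lambda>(c::'a) (x::'a). c * x) \<phi>" "\<phi> e = 1"
    by auto
  interpret L: Vector_Spaces.linear "\<lambda>(c::'a) (x::'a alg_closure). to_ac c * x" "\<lambda>(c::'a) (x::'a). c * x" \<phi>
    by (rule \<phi>(1))
  show ?thesis using L.add L.scale \<phi>(2) by (intro exI[of _ \<phi>]) auto
qed

lemma span_pow_eq_sum:
  assumes "Z \<in> fpsm.span {fsub 1 (k ^ j) F |j. j \<ge> 1}"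
  shows "\<exists>n\<ge>1. \<exists>C. Z = (\<Sum>j=1..n. fps_of_poly (C j) * fsub 1 (k ^ j) F)"
  using assms
proof (induction rule: fpsm.span_induct_alt)
  case base
  show ?case by (intro exI[of _ 1] conjI exI[of _ "\<lambda>_. 0"]) auto
next
  case (step p x y)
  then obtain n C j where C: "n \<ge> 1" "y = (\<Sum>j=1..n. fps_of_poly (C j) * fsub 1 (k ^ j) F)"
    and j: "j \<ge> 1" "x = fsub 1 (k ^ j) F" by blast
  let ?g = "\<lambda>j. fsub 1 (k ^ j) F"
  have "y \<in> fpsm.span (?g ` {1..max n j})"
    unfolding C(2) by (intro fpsm.span_sum fpsm.span_scale fpsm.span_base) auto
  moreover have "fps_of_poly p * x \<in> fpsm.span (?g ` {1..max n j})"
    unfolding j(2) using j(1) by (intro fpsm.span_scale fpsm.span_base) auto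
  ultimately have "fps_of_poly p * x + y \<in> fpsm.span (?g ` {1..max n j})"
    by (rule fpsm.span_add[rotated])
  from span_image_sum[OF _ this] show ?case using C(1) by (intro exI[of _ "max n j"]) auto
qed

lemma mahler_equation_iff_span:
  "mahler_equation k F P \<longleftrightarrow> fps_of_poly P * F \<in> fpsm.span {fsub 1 (k ^ j) F |j. j \<ge> 1}"
proof
  assume "mahler_equation k F P"
  then obtain n C where C: "fps_of_poly P * F = (\<Sum>j=1..n. fps_of_poly (C j) * fsub 1 (k ^ j) F)"
    unfolding mahler_equation_def fsub_X_power by blast
  show "fps_of_poly P * F \<in> fpsm.span {fsub 1 (k ^ j) F |j. j \<ge> 1}"
    unfolding C by (intro fpsm.span_sum fpsm.span_scale fpsm.span_base) auto
next
  assume "fps_of_poly P * F \<in> fpsm.span {fsub 1 (k ^ j) F |j. j \<ge> 1}"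
  from span_pow_eq_sum[OF this] show "mahler_equation k F P"
    unfolding mahler_equation_def fsub_X_power .
qed

lemma mahler_denom_properties:
  fixes F :: "'a::field fps"
  assumes "mahler k F"
  shows "mahler_denom k F \<noteq> 0" and "mahler_equation k F P \<longleftrightarrow> mahler_denom k F dvd P"
proof -
  let ?d = "mahler_denom k F"
  have *: "mahler_ideal k F = {p. ?d dvd p}"
    using theI'[OF mahler_denom_ex1[OF assms]] unfolding mahler_denom_def by blast
  show "mahler_equation k F P \<longleftrightarrow> ?d dvd P" using * mem_mahler_ideal_iff by blast
  show "?d \<noteq> 0"
  proof
    assume "?d = 0"
    moreover obtain P where "P \<noteq> 0" "mahler_equation k F P" using assms by (auto simp: mahler_def)
    then have "P \<in> mahler_ideal k F" by (simp add: mem_mahler_ideal_iff)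
    ultimately show False using * \<open>P \<noteq> 0\<close> by simp
  qed
qed

locale functional =
  fixes \<phi> :: "'a::field alg_closure \<Rightarrow> 'a"
  assumes add: "\<phi> (x + y) = \<phi> x + \<phi> y" and scale: "\<phi> (to_ac c * x) = c * \<phi> x"
begin

lemma zero [simp]: "\<phi> 0 = 0"
  using scale[of 0 0] by simp

lemma sum: "\<phi> (sum f A) = (\<Sum>x\<in>A. \<phi> (f x))"
  by (induction A rule: infinite_finite_induct) (simp_all add: add)

lemma scale_right: "\<phi> (x * to_ac c) = \<phi> x * c"
  using scale[of c x] by (simp add: mult.commute)

definition fl :: "'a alg_closure fps \<Rightarrow> 'a fps" where
  "fl Z = Abs_fps (\<lambda>n. \<phi> (Z $ n))"

lemma fl_add: "fl (Y + Z) = fl Y + fl Z"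
  by (rule fps_ext) (simp add: fl_def add)

lemma fl_0: "fl 0 = 0"
  by (rule fps_ext) (simp add: fl_def)

text \<open>\<open>\<phi>\<close> is not assumed multiplicative; linearity suffices because one
  factor has its coefficients in K.\<close>

lemma fl_mult_fac: "fl (fps_of_poly P * fac F) = fps_of_poly (map_poly \<phi> P) * F"
  by (rule fps_ext) (simp add: fl_def fps_mult_nth sum scale_right coeff_map_poly)

lemma map_poly_mult_acp: "map_poly \<phi> (P * acp p) = map_poly \<phi> P * p"
  by (rule poly_eqI) (simp add: coeff_map_poly coeff_mult sum scale_right)

lemma map_poly_add: "map_poly \<phi> (P + Q) = map_poly \<phi> P + map_poly \<phi> Q"
  by (rule poly_eqI) (simp add: coeff_map_poly add)

lemma descend_span:
  assumes "k > 0" "Z \<in> fpsm.span {fsub 1 (k ^ j) (fac F) |j. j \<ge> 1}"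
  shows "fl Z \<in> fpsm.span {fsub 1 (k ^ j) F |j. j \<ge> 1}"
  using assms(2)
proof (induction rule: fpsm.span_induct_alt)
  case base
  show ?case by (simp add: fl_0 fpsm.span_zero)
next
  case (step p x y)
  then obtain j where j: "j \<ge> 1" "x = fac (fsub 1 (k ^ j) F)"
    using assms(1) by (auto simp: fac_fsub)
  have "fps_of_poly (map_poly \<phi> p) * fsub 1 (k ^ j) F \<in> fpsm.span {fsub 1 (k ^ j) F |j. j \<ge> 1}"
    using j(1) by (intro fpsm.span_scale fpsm.span_base) auto
  then show ?case using step.IH unfolding j(2) fl_add fl_mult_fac by (rule fpsm.span_add)
qed

end

text \<open>
  Relations over the algebraic closure descend to \<open>K\<close> by applying \<open>K\<close>-linear functionals to
  the coefficients, so the Mahler denominator does not change.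
\<close>

lemma acp_mahler_denom_dvd:
  fixes F :: "'a::field fps"
  assumes "mahler k F" "k > 0"
    and P: "fps_of_poly P * fac F \<in> fpsm.span {fsub 1 (k ^ j) (fac F) |j. j \<ge> 1}"
  shows "acp (mahler_denom k F) dvd P"
proof (rule ccontr)
  let ?d = "mahler_denom k F"
  assume "\<not> acp ?d dvd P"
  then have R0: "P mod acp ?d \<noteq> 0" by (simp add: mod_eq_0_iff_dvd)
  define R where "R = P mod acp ?d"
  have d0: "?d \<noteq> 0" by (rule mahler_denom_properties[OF assms(1)])
  \<comment> \<open>Keeping the leading coefficient of the remainder alive makes its image nonzero,
    and too low in degree to be a multiple of the denominator.\<close>
  obtain \<phi> :: "'a alg_closure \<Rightarrow> 'a" where
    \<phi>: "\<And>x y. \<phi> (x + y) = \<phi> x + \<phi> y" "\<And>c x. \<phi> (to_ac c * x) = c * \<phi> x" "\<phi> (lead_coeff R) \<noteq> 0"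
    using exists_functional[of "lead_coeff R"] R0 unfolding R_def by auto
  interpret functional \<phi> by unfold_locales (fact \<phi>)+
  have "fps_of_poly (map_poly \<phi> P) * F \<in> fpsm.span {fsub 1 (k ^ j) F |j. j \<ge> 1}"
    using descend_span[OF assms(2) P] by (simp add: fl_mult_fac)
  then have "?d dvd map_poly \<phi> P"
    unfolding mahler_equation_iff_span[symmetric] mahler_denom_properties[OF assms(1)] .
  moreover have "map_poly \<phi> P = map_poly \<phi> (P div acp ?d) * ?d + map_poly \<phi> R"
    unfolding R_def by (simp only: map_poly_mult_acp[symmetric] map_poly_add[symmetric] div_mult_mod_eq)
  ultimately have dvd: "?d dvd map_poly \<phi> R" by (metis dvd_add_right_iff dvd_triv_right)
  have "coeff (map_poly \<phi> R) (degree R) \<noteq> 0" using \<phi>(3) by (simp add: coeff_map_poly)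
  then have "map_poly \<phi> R \<noteq> 0" by auto
  then have "degree ?d \<le> degree (map_poly \<phi> R)" using dvd by (rule dvd_imp_degree_le[rotated])
  also have "\<dots> \<le> degree R" by (rule map_poly_degree_leq)
  also have "\<dots> < degree (acp ?d)"
    using degree_mod_less[of "acp ?d" P] d0 R0 unfolding R_def by auto
  finally show False by simp
qed

section \<open>Roots of unity in the splitting field\<close>

lemma inv_ring_of_type_algebra:
  assumes "x \<noteq> (0::'a::field)"
  shows "inv\<^bsub>ring_of_type_algebra\<^esub> x = inverse x"
  unfolding m_inv_def using assms
  by (intro the_equality) (auto simp: ring_of_type_algebra_def field_simps)

lemma generate_field_closed:
  fixes S :: "'a::field set"
  defines "L \<equiv> generate_field ring_of_type_algebra S"
  shows "1 \<in> L" "x \<in> L \<Longrightarrow> y \<in> L \<Longrightarrow> x * y \<in> L" "x \<in> L \<Longrightarrow> x \<noteq> 0 \<Longrightarrow> inverse x \<in> L" "S \<subseteq> L"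
proof -
  show "1 \<in> L" using generate_field.one[of ring_of_type_algebra S]
    by (simp add: L_def ring_of_type_algebra_def)
  show "x * y \<in> L" if "x \<in> L" "y \<in> L"
    using generate_field.eng_mult[of x ring_of_type_algebra S y] that
    by (simp add: L_def ring_of_type_algebra_def)
  show "inverse x \<in> L" if "x \<in> L" "x \<noteq> 0"
    using generate_field.m_inv[of x ring_of_type_algebra S] that inv_ring_of_type_algebra[OF that(2)]
    by (simp add: L_def) (simp add: ring_of_type_algebra_def)
  show "S \<subseteq> L" unfolding L_def using generate_field.incl by fast
qed

text \<open>If both \<open>a\<close> and \<open>\<eta> * a ^ N\<close> are roots, their quotient
  puts \<open>\<eta>\<close> into L. The hypothesis speaks of q-th roots of unity only, but the last
  power \<open>\<eta> ^ (q ^ j)\<close> before 1 is reached is one of these.\<close>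

lemma tors_twist_not_root:
  fixes F :: "'a::field fps"
  assumes roots: "\<forall>z\<in>mahler_splitting_field k F. z ^ q = 1 \<longrightarrow> z = 1"
    and a: "a \<noteq> 0" "poly (acp (mahler_denom k F)) a = 0"
    and \<eta>: "\<eta> \<in> tors q m"
  shows "poly (acp (mahler_denom k F)) (\<eta> * a ^ N) \<noteq> 0"
proof
  assume root: "poly (acp (mahler_denom k F)) (\<eta> * a ^ N) = 0"
  let ?L = "mahler_splitting_field k F"
  note closed = generate_field_closed[where S = "{z. poly (acp (mahler_denom k F)) z = 0}",
      folded mahler_splitting_field_def]
  have power: "x ^ n \<in> ?L" if "x \<in> ?L" for x n
    using that closed(1,2) by (induction n) auto
  have "a \<in> ?L" "\<eta> * a ^ N \<in> ?L" using closed(4) a(2) root by auto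
  then have "\<eta> * a ^ N * inverse (a ^ N) \<in> ?L"
    using a(1) power closed(2,3) by simp
  moreover have "\<eta> * a ^ N * inverse (a ^ N) = \<eta>"
    unfolding mult.assoc using a(1) by (subst right_inverse) auto
  ultimately have \<eta>L: "\<eta> \<in> ?L" by metis
  define i where "i = (LEAST i. \<eta> ^ (q ^ i) = 1)"
  have "\<eta> ^ (q ^ m) = 1" using \<eta> by (simp add: tors_def)
  then have i: "\<eta> ^ (q ^ i) = 1" unfolding i_def by (rule LeastI)
  have "i \<noteq> 0" using i \<eta> by (intro notI) (simp add: tors_def)
  then obtain j where j: "i = Suc j" by (cases i) auto
  have "(\<eta> ^ (q ^ j)) ^ q = 1" using i unfolding j by (simp add: mult.commute flip: power_mult)
  then have "\<eta> ^ (q ^ j) = 1" using roots power[OF \<eta>L] by blast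
  then have "i \<le> j" unfolding i_def by (rule Least_le)
  then show False using j by simp
qed

section \<open>Regularity\<close>

lemma fsec_fsec: "fsec k i (fsec K r F) = fsec (K * k) (K * i + r) F"
  by (rule fps_ext) (simp add: fsec_def algebra_simps)

lemma k_kernel_subset_sections:
  fixes F :: "'a::field fps"
  assumes "k > 0" and F: "F \<in> V" and V: "\<And>i Z. i < k \<Longrightarrow> Z \<in> V \<Longrightarrow> fsec k i Z \<in> V"
  shows "k_kernel k (fps_nth F) \<subseteq> fps_nth ` V"
proof
  have *: "fsec (k ^ e) r F \<in> V" if "r < k ^ e" for e r
    using that
  proof (induction e arbitrary: r)
    case 0
    then have "fsec (k ^ 0) r F = F" by (intro fps_ext) (simp add: fsec_def)
    then show ?case using F by simp
  next
    case (Suc e)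
    have "r div k ^ e < k" using Suc.prems by (simp add: less_mult_imp_div_less)
    moreover have "fsec (k ^ e) (r mod k ^ e) F \<in> V" using assms(1) by (intro Suc.IH) simp
    ultimately have "fsec k (r div k ^ e) (fsec (k ^ e) (r mod k ^ e) F) \<in> V" by (rule V)
    then show ?case by (simp add: fsec_fsec mult.commute)
  qed
  fix g assume "g \<in> k_kernel k (fps_nth F)"
  then obtain e r where "r < k ^ e" "g = (\<lambda>n. F $ (k ^ e * n + r))" by (auto simp: k_kernel_def)
  then have "g = fps_nth (fsec (k ^ e) r F)" "fsec (k ^ e) r F \<in> V"
    using * by (auto simp: fsec_def)
  then show "g \<in> fps_nth ` V" by blast
qed

lemma fps_of_poly_expand:
  fixes p :: "'e::field poly"
  assumes "degree p \<le> m"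
  shows "fps_of_poly p * Y = (\<Sum>i\<le>m. fps_const (coeff p i) * (fps_X ^ i * Y))"
proof -
  have "p = (\<Sum>i\<le>m. monom (coeff p i) i)"
    using poly_as_sum_of_monoms'[OF assms] by simp
  from arg_cong[OF this, of fps_of_poly]
  have "fps_of_poly p = (\<Sum>i\<le>m. fps_const (coeff p i) * fps_X ^ i)"
    unfolding fps_of_poly_sum fps_of_poly_monom .
  then show ?thesis by (simp add: sum_distrib_right mult.assoc)
qed

lemma sum_apply: "sum f A x = (\<Sum>a\<in>A. f a x)"
  for f :: "'b \<Rightarrow> 'c \<Rightarrow> 'd::comm_monoid_add"
  by (induction A rule: infinite_finite_induct) simp_all

text \<open>Finite dimension is known for the products D Z only. Multiplication by \<open>D\<close>
  is linear and injective, so a basis of the kernel's span is carried to an independent set in the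
  span of \<open>B\<close>.\<close>

lemma k_regularI:
  fixes F D :: "'a::field fps"
  assumes D: "D \<noteq> 0" and B: "finite B"
    and V: "\<And>Z. Z \<in> V \<Longrightarrow> fps_nth (D * Z) \<in> seq_span B"
    and kernel: "k_kernel k (fps_nth F) \<subseteq> fps_nth ` V"
  shows "k_regular k F"
proof -
  interpret S: vector_space "\<lambda>(c::'a) (g::nat \<Rightarrow> 'a) n. c * g n" by (rule seq_vector_space)
  interpret SP: vector_space_pair "\<lambda>(c::'a) (g::nat \<Rightarrow> 'a) n. c * g n" "\<lambda>(c::'a) (g::nat \<Rightarrow> 'a) n. c * g n" ..
  define T where "T g = fps_nth (D * Abs_fps g)" for g
  have lin: "Vector_Spaces.linear (\<lambda>(c::'a) (g::nat \<Rightarrow> 'a) n. c * g n) (\<lambda>(c::'a) (g::nat \<Rightarrow> 'a) n. c * g n) T"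
  proof (unfold_locales)
    show "T (x + y) = T x + T y" for x y
      by (rule ext) (simp add: T_def fps_mult_nth algebra_simps sum.distrib)
    show "T (\<lambda>n. c * x n) = (\<lambda>n. c * T x n)" for c x
      by (rule ext) (simp add: T_def fps_mult_nth sum_distrib_left algebra_simps)
  qed
  interpret T: Vector_Spaces.linear "\<lambda>(c::'a) (g::nat \<Rightarrow> 'a) n. c * g n" "\<lambda>(c::'a) (g::nat \<Rightarrow> 'a) n. c * g n" T
    by (rule lin)
  have inj: "inj T"
  proof (rule injI)
    fix x y assume "T x = T y"
    then have "D * Abs_fps x = D * Abs_fps y" by (simp add: T_def fps_nth_inject)
    then have "Abs_fps x = Abs_fps y" using D by simp
    then show "x = y" by (metis fps_nth_Abs_fps ext)
  qed
  obtain A where A: "A \<subseteq> k_kernel k (fps_nth F)" "S.independent A" "k_kernel k (fps_nth F) \<subseteq> S.span A"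
    using S.maximal_independent_subset by blast
  have "T ` A \<subseteq> S.span B"
  proof
    fix g assume "g \<in> T ` A"
    then obtain Z where "Z \<in> V" "g = T (fps_nth Z)" using A(1) kernel by blast
    then show "g \<in> S.span B" using V[of Z] by (simp add: T_def fps_nth_inverse)
  qed
  moreover have "S.independent (T ` A)" using A(2) inj by (rule T.independent_inj_image)
  ultimately have "finite (T ` A)" using S.independent_span_bound[OF B] by blast
  then have "finite A" using inj by (meson finite_imageD inj_on_subset subset_UNIV)
  moreover have "S.span A = S.span (k_kernel k (fps_nth F))"
    using A S.span_mono[OF A(1)] S.span_minimal[OF A(3) S.subspace_span] by blast
  ultimately show ?thesis unfolding k_regular_def by blast
qed

text \<open>Since D(x^k) Z = Q (D Z), the denominator \<open>D\<close> survives sections: the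
  equation for Q F replaces the one term that is not visibly a substitution. Coefficient degrees at
  most double in this step, and a section at least halves them because k >= 2.\<close>

lemma k_regular_if_invariant_denominator:
  fixes F :: "'a::field fps"
  assumes k: "k \<ge> 2" and D: "D \<noteq> 0" "psub 1 k D = D * Q" and P: "mahler_equation k F Q"
  shows "k_regular k F"
proof -
  have k0: "k > 0" using k by simp
  obtain n P where n: "n \<ge> 1" and rel: "fps_of_poly Q * F = (\<Sum>j=1..n. fps_of_poly (P j) * fsub 1 (k ^ j) F)"
    using P unfolding mahler_equation_def fsub_X_power by blast
  define \<delta> where "\<delta> = Max (insert (degree D) (insert (degree Q) ((\<lambda>j. degree (P j)) ` {1..n})))"
  have \<delta>: "degree D \<le> \<delta>" "degree Q \<le> \<delta>" "\<And>j. j \<in> {1..n} \<Longrightarrow> degree (P j) \<le> \<delta>"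
    unfolding \<delta>_def by (rule Max_ge; fastforce)+
  define M where "M j = fsub 1 (k ^ j) F" for j
  have M_Suc: "fsub 1 k (M j) = M (Suc j)" for j using k0 by (simp add: M_def fsub_fsub)
  have M_0: "M 0 = F" by (simp add: M_def)
  define V where "V = {Z. \<exists>R. (\<forall>j<n. degree (R j) \<le> \<delta>) \<and>
      fps_of_poly D * Z = (\<Sum>j<n. fps_of_poly (R j) * M j)}"
  have FV: "F \<in> V"
  proof -
    have "(\<Sum>j<n. fps_of_poly (if j = 0 then D else 0) * M j) = (\<Sum>j<n. if j = 0 then fps_of_poly D * F else 0)"
      by (intro sum.cong) (auto simp: M_0)
    also have "\<dots> = fps_of_poly D * F" using n by (subst sum.delta) auto
    finally show ?thesis unfolding V_def using \<delta>(1)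
      by (intro CollectI exI[of _ "\<lambda>j. if j = 0 then D else 0"]) auto
  qed
  have sec: "fsec k i Z \<in> V" if i: "i < k" and Z: "Z \<in> V" for i Z
  proof -
    obtain R where R: "\<And>j. j < n \<Longrightarrow> degree (R j) \<le> \<delta>"
      "fps_of_poly D * Z = (\<Sum>j<n. fps_of_poly (R j) * M j)"
      using Z by (auto simp: V_def)
    obtain n' where n': "n = Suc n'" using n by (cases n) auto
    \<comment> \<open>The coefficient of \<open>M (Suc j)\<close> in D(x^k) Z.\<close>
    define R' where "R' j = R 0 * P (Suc j) + (if Suc j < n then Q * R (Suc j) else 0)" for j
    have deg: "degree (R' j) \<le> 2 * \<delta>" if "j < n" for j
    proof -
      have "degree (R 0 * P (Suc j)) \<le> 2 * \<delta>"
        using degree_mult_le[of "R 0" "P (Suc j)"] R(1)[of 0] \<delta>(3)[of "Suc j"] n that by auto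
      moreover have "degree (if Suc j < n then Q * R (Suc j) else 0) \<le> 2 * \<delta>"
        using degree_mult_le[of Q "R (Suc j)"] R(1)[of "Suc j"] \<delta>(2) by auto
      ultimately show ?thesis unfolding R'_def by (rule degree_add_le)
    qed
    have "fps_of_poly (psub 1 k D) * Z = fps_of_poly Q * (fps_of_poly D * Z)"
      by (simp add: D(2) fps_of_poly_mult mult_ac)
    also have "\<dots> = fps_of_poly (R 0) * (fps_of_poly Q * F) +
        (\<Sum>j<n'. fps_of_poly (Q * R (Suc j)) * M (Suc j))"
      unfolding R(2) n' sum.lessThan_Suc_shift
      by (simp add: M_0 distrib_left sum_distrib_left fps_of_poly_mult mult_ac)
    also have "fps_of_poly (R 0) * (fps_of_poly Q * F) = (\<Sum>j<n. fps_of_poly (R 0 * P (Suc j)) * M (Suc j))"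
      unfolding rel M_def[symmetric] image_Suc_lessThan[symmetric]
      by (subst sum.reindex) (simp_all add: sum_distrib_left fps_of_poly_mult mult.assoc)
    also have "(\<Sum>j<n'. fps_of_poly (Q * R (Suc j)) * M (Suc j)) =
        (\<Sum>j<n. fps_of_poly (if Suc j < n then Q * R (Suc j) else 0) * M (Suc j))"
      unfolding n' by simp
    finally have eq: "fps_of_poly (psub 1 k D) * Z = (\<Sum>j<n. fps_of_poly (R' j) * M (Suc j))"
      by (simp add: R'_def fps_of_poly_add distrib_right sum.distrib)
    have "fps_of_poly D * fsec k i Z = fsec k i (Z * fsub 1 k (fps_of_poly D))"
      using k0 i by (simp add: fsec_mult_fsub mult.commute)
    also have "Z * fsub 1 k (fps_of_poly D) = (\<Sum>j<n. fps_of_poly (R' j) * fsub 1 k (M j))"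
      using eq k0 by (simp add: fsub_of_poly mult.commute M_Suc)
    also have "fsec k i \<dots> = (\<Sum>j<n. fps_of_poly (psec k i (R' j)) * M j)"
      using k0 i by (simp add: fsec_sum fsec_poly_mult_fsub)
    finally have "fps_of_poly D * fsec k i Z = (\<Sum>j<n. fps_of_poly (psec k i (R' j)) * M j)" .
    moreover have "degree (psec k i (R' j)) \<le> \<delta>" if "j < n" for j
    proof -
      have "2 * degree (psec k i (R' j)) \<le> k * degree (psec k i (R' j))" using k by simp
      also have "\<dots> \<le> degree (R' j)" by (rule degree_psec_le[OF k0])
      also have "\<dots> \<le> 2 * \<delta>" by (rule deg[OF that])
      finally show ?thesis by simp
    qed
    ultimately show ?thesis unfolding V_def by (intro CollectI exI[of _ "\<lambda>j. psec k i (R' j)"]) auto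
  qed
  let ?B = "(\<lambda>(i, j). fps_nth (fps_X ^ i * M j)) ` ({..\<delta>} \<times> {..<n})"
  interpret S: vector_space "\<lambda>(c::'a) (g::nat \<Rightarrow> 'a) n. c * g n" by (rule seq_vector_space)
  have "fps_nth (fps_of_poly D * Z) \<in> seq_span ?B" if Z: "Z \<in> V" for Z
  proof -
    obtain R where R: "\<And>j. j < n \<Longrightarrow> degree (R j) \<le> \<delta>"
      "fps_of_poly D * Z = (\<Sum>j<n. fps_of_poly (R j) * M j)"
      using Z by (auto simp: V_def)
    have "fps_of_poly D * Z = (\<Sum>j<n. \<Sum>i\<le>\<delta>. fps_const (coeff (R j) i) * (fps_X ^ i * M j))"
      unfolding R(2) by (intro sum.cong refl fps_of_poly_expand R(1)) simp
    then have "fps_nth (fps_of_poly D * Z) =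
        (\<Sum>j<n. \<Sum>i\<le>\<delta>. (\<lambda>m. coeff (R j) i * fps_nth (fps_X ^ i * M j) m))"
      by (intro ext) (simp add: fps_sum_nth sum_apply)
    also have "\<dots> \<in> S.span ?B"
      by (intro S.span_sum S.span_scale S.span_base) auto
    finally show ?thesis .
  qed
  then show ?thesis
    using D(1) k_kernel_subset_sections[OF k0 FV sec] by (intro k_regularI[of "fps_of_poly D" ?B V]) auto
qed

section \<open>Regularity from the position of the roots\<close>

lemma dvd_power_degree:
  fixes P Q :: "'e::alg_closed_field poly"
  assumes "P \<noteq> 0" "\<And>b. poly P b = 0 \<Longrightarrow> poly Q b = 0"
  shows "P dvd Q ^ degree P"
  using assms
proof (induction "degree P" arbitrary: P)
  case 0
  then have "is_unit P" by (simp add: is_unit_iff_degree)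
  then show ?case by (rule unit_imp_dvd)
next
  case (Suc n)
  then obtain b where b: "poly P b = 0" using alg_closed_imp_poly_has_root[of P] by auto
  then obtain P' where P': "P = [:-b, 1:] * P'" unfolding poly_eq_0_iff_dvd by (elim dvdE)
  have "P' \<noteq> 0" using Suc.prems(1) P' by auto
  moreover have "degree P = Suc (degree P')"
    unfolding P' using \<open>P' \<noteq> 0\<close> by (subst degree_mult_eq) auto
  moreover have "poly Q b' = 0" if "poly P' b' = 0" for b' using Suc.prems(2) P' that by simp
  ultimately have "P' dvd Q ^ degree P'" using Suc.hyps by auto
  moreover have "[:-b, 1:] dvd Q" using Suc.prems(2)[OF b] by (simp add: poly_eq_0_iff_dvd)
  ultimately have "[:-b, 1:] * P' dvd Q * Q ^ degree P'" by (rule mult_dvd_mono[rotated])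
  then show ?case using \<open>degree P = Suc (degree P')\<close> P' by simp
qed

text \<open>Common factors with \<open>k\<close> are moved into a power of \<open>k\<close>, one gcd
  at a time.\<close>

lemma exists_coprime_part:
  assumes "M > 0" "k > (0::nat)"
  shows "\<exists>N T. N > 0 \<and> coprime N k \<and> M dvd N * k ^ T"
  using assms(1)
proof (induction M rule: less_induct)
  case (less M)
  show ?case
  proof (cases "coprime M k")
    case True
    then show ?thesis using less.prems by (intro exI[of _ M] exI[of _ 0]) auto
  next
    case False
    define g where "g = gcd M k"
    have "g > 0" using less.prems by (simp add: g_def)
    moreover have "g \<noteq> 1" using False by (simp add: g_def coprime_iff_gcd_eq_1)
    ultimately have g: "g > 1" by linarith
    obtain M' where M': "M = g * M'" using g_def by (metis dvdE gcd_dvd1)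
    have "M' > 0" "M' < M" using less.prems g unfolding M' by auto
    then obtain N T where N: "N > 0" "coprime N k" "M' dvd N * k ^ T" using less.IH by blast
    have "g dvd k" by (simp add: g_def)
    from mult_dvd_mono[OF this N(3)] show ?thesis
      using N unfolding M' by (intro exI[of _ N] exI[of _ "Suc T"]) (simp add: mult_ac)
  qed
qed

text \<open>
  With \<open>c\<close> large, the denominator divides \<open>D(x\<^sup>k) / D\<close> for
  \<open>D = x\<^sup>c (\<Prod>t<T. x ^ (N k\<^sup>t) - 1)\<^sup>c\<close>: this quotient vanishes at \<open>0\<close> and at all roots of unity
  \<open>b\<close> with \<open>b ^ (N k\<^sup>T) = 1\<close> and \<open>b\<^sup>N \<noteq> 1\<close>.
\<close>

lemma k_regular_if_roots:
  fixes F :: "'a::field fps"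
  assumes k: "k \<ge> 2" and F: "mahler k F"
    and roots: "\<And>b. poly (acp (mahler_denom k F)) b = 0 \<Longrightarrow> b \<noteq> 0 \<Longrightarrow>
      (\<exists>N>0. b ^ N = 1) \<and> (\<forall>N>0. coprime N k \<longrightarrow> b ^ N \<noteq> 1)"
  shows "k_regular k F"
proof -
  let ?d = "mahler_denom k F"
  have d0: "?d \<noteq> 0" by (rule mahler_denom_properties[OF F])
  define S where "S = {b. poly (acp ?d) b = 0 \<and> b \<noteq> 0}"
  have "finite S" using poly_roots_finite[of "acp ?d"] d0 by (auto simp: S_def)
  have "\<forall>b\<in>S. \<exists>N>0. b ^ N = 1" using roots by (auto simp: S_def)
  then obtain ord where ord: "\<And>b. b \<in> S \<Longrightarrow> ord b > 0 \<and> b ^ ord b = 1" by metis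
  define M where "M = (\<Prod>b\<in>S. ord b)"
  have "M > 0" unfolding M_def using ord by (intro prod_pos) auto
  then obtain N T where N: "N > 0" "coprime N k" "M dvd N * k ^ T"
    using exists_coprime_part k by (metis less_le_trans zero_less_numeral)
  have bNT: "b ^ (N * k ^ T) = 1" if "b \<in> S" for b
  proof -
    have "ord b dvd M" unfolding M_def using \<open>finite S\<close> that by (intro dvd_prodI)
    then have "ord b dvd N * k ^ T" using N(3) dvd_trans by blast
    then obtain m where m: "N * k ^ T = ord b * m" by (elim dvdE)
    show ?thesis unfolding m using ord[OF that] by (simp add: power_mult)
  qed
  obtain W :: "'a poly" where W: "cyclo (N * k ^ T) = cyclo N * W"
    using cyclo_mult by blast
  define U where "U = monom 1 1 * W"
  have Ub: "poly (acp U) b = 0" if "poly (acp ?d) b = 0" for b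
  proof (cases "b = 0")
    case True
    then show ?thesis by (simp add: U_def acp_mult map_poly_monom poly_monom)
  next
    case False
    then have b: "b \<in> S" using that by (simp add: S_def)
    have "poly (acp (cyclo (N * k ^ T))) b = poly (acp (cyclo N)) b * poly (acp W) b"
      unfolding W by (simp add: acp_mult)
    then have "(b ^ N - 1) * poly (acp W) b = 0"
      using bNT[OF b] by (simp add: acp_cyclo poly_cyclo)
    moreover have "b ^ N \<noteq> 1" using roots[OF that False] N by blast
    ultimately show ?thesis by (simp add: U_def acp_mult)
  qed
  define c where "c = degree (acp ?d)"
  have "acp ?d dvd acp U ^ c" unfolding c_def
    using d0 Ub by (intro dvd_power_degree) auto
  then have "?d dvd U ^ c" by (simp only: acp_dvd_iff flip: acp_power)
  define Pr where "Pr = (\<Prod>t<T. cyclo (N * k ^ t) :: 'a poly)"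
  \<comment> \<open>Telescoping: x -> x^k shifts the factors of \<open>Pr\<close> by one, so only
    the two outer factors remain in the quotient.\<close>
  have "cyclo N * psub 1 k Pr = cyclo N * (Pr * W)"
  proof -
    have "psub 1 k Pr = (\<Prod>t<T. cyclo (N * k ^ Suc t))"
      unfolding Pr_def by (induction T) (simp_all add: psub_mult psub_cyclo mult_ac)
    then have "cyclo N * psub 1 k Pr = (\<Prod>t<Suc T. cyclo (N * k ^ t))"
      by (simp only: prod.lessThan_Suc_shift) simp
    also have "\<dots> = Pr * (cyclo N * W)" by (simp add: Pr_def W)
    finally show ?thesis by (simp add: mult_ac)
  qed
  then have Pr: "psub 1 k Pr = Pr * W" using cyclo_nonzero[OF N(1)] by (metis mult_left_cancel)
  define D where "D = monom 1 1 ^ c * Pr ^ c"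
  define Q where "Q = (monom 1 1 ^ (k - 1)) ^ c * W ^ c"
  have X: "psub 1 k (monom 1 1) = monom 1 1 * monom 1 1 ^ (k - 1)"
    using k by (cases k) (simp_all add: psub_monom monom_power mult_monom)
  have "psub 1 k D = D * Q"
    unfolding D_def Q_def psub_mult psub_power X Pr power_mult_distrib by (simp only: mult_ac)
  moreover have "D \<noteq> 0"
    using k N(1) by (auto simp: D_def Pr_def cyclo_nonzero)
  moreover have "?d dvd Q"
  proof -
    \<comment> \<open>k >= 2 enters here: x divides x^(k-1), which accounts for a root of the
      denominator at 0.\<close>
    have "U dvd monom 1 1 ^ (k - 1) * W"
      unfolding U_def using k by (intro mult_dvd_mono dvd_power) auto
    then have "U ^ c dvd Q" unfolding Q_def power_mult_distrib[symmetric] by (rule dvd_power_same)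
    then show ?thesis using \<open>?d dvd U ^ c\<close> dvd_trans by blast
  qed
  then have "mahler_equation k F Q" by (simp add: mahler_denom_properties[OF F])
  ultimately show ?thesis using k_regular_if_invariant_denominator[OF k] by blast
qed

theorem theorem7p1:
  fixes F :: "'a::field_char_0 fps" and k q :: nat
  assumes "k \<ge> 2"
    and "fps_nth F 0 = 0"
    and "mahler k F"
    and "q \<ge> 3"
    and "\<forall>n. fps_nth F (q * n) = fps_nth F q * fps_nth F n"
    and "\<forall>z \<in> mahler_splitting_field k F. z ^ q = 1 \<longrightarrow> z = 1"
    and "gcd q k = 1"
  shows "k_regular k F"
proof (rule k_regular_if_roots[OF assms(1,3)])
  let ?d = "mahler_denom k F"
  have d: "?d \<noteq> 0" "mahler_equation k F ?d"
    using mahler_denom_properties[OF assms(3)] by auto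
  from d(2) obtain n P where n: "n \<ge> 1"
    and rel: "fps_of_poly ?d * F = (\<Sum>j=1..n. fps_of_poly (P j) * fsub 1 (k ^ j) F)"
    unfolding mahler_equation_def fsub_X_power by blast
  have "fac (fps_of_poly ?d * F) = fac (\<Sum>j=1..n. fps_of_poly (P j) * fsub 1 (k ^ j) F)"
    using rel by simp
  then have rel': "fps_of_poly (acp ?d) * fac F =
      (\<Sum>j=1..n. fps_of_poly (acp (P j)) * fsub 1 (k ^ j) (fac F))"
    using assms(1) by (simp add: fac_mult fac_sum fac_of_poly fac_fsub)
  interpret mahler_q_multiplicative "fac F" k q "to_ac (F $ q)" "acp ?d" n "\<lambda>j. acp (P j)"
    using assms(1,4,5,7) n d(1) rel' by unfold_locales (auto simp: coprime_iff_gcd_eq_1)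
  fix a assume a: "poly (acp ?d) a = 0" "a \<noteq> 0"
  have twist: "poly (acp ?d) (\<eta> * a ^ (k ^ s)) \<noteq> 0" if "\<eta> \<in> tors q m" for \<eta> m s
    by (rule tors_twist_not_root[OF assms(6) a(2,1) that])
  have no_relation: "\<not> (\<exists>P. poly P a \<noteq> 0 \<and> fps_of_poly P * fac F \<in> VV)"
  proof
    assume "\<exists>P. poly P a \<noteq> 0 \<and> fps_of_poly P * fac F \<in> VV"
    then obtain P where P: "poly P a \<noteq> 0" "fps_of_poly P * fac F \<in> VV" by blast
    have "acp ?d dvd P" by (rule acp_mahler_denom_dvd[OF assms(3) k_pos P(2)])
    then show False using P(1) a(1) by (auto elim!: dvdE)
  qed
  show "(\<exists>N>0. a ^ N = 1) \<and> (\<forall>N>0. coprime N k \<longrightarrow> a ^ N \<noteq> 1)"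
  proof (intro conjI allI impI notI)
    show "\<exists>N>0. a ^ N = 1"
    proof (rule ccontr)
      assume "\<not> (\<exists>N>0. a ^ N = 1)"
      then have "a ^ N \<noteq> 1" if "N > 0" for N using that by blast
      then have "\<exists>P. poly P a \<noteq> 0 \<and> fps_of_poly P * fac F \<in> VV"
        by (intro not_root_of_unity_case twist a(2))
      then show False using no_relation by contradiction
    qed
  next
    fix N :: nat assume "N > 0" "coprime N k" "a ^ N = 1"
    then have "\<exists>P. poly P a \<noteq> 0 \<and> fps_of_poly P * fac F \<in> VV"
      by (intro root_of_unity_case[of a N] twist)
    then show False using no_relation by contradiction
  qed
qed

end
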